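(* Let $m\ge 2$, let $\epsilon=\{\epsilon_I\}_{I\in\mathcal{D}}$ be a sequence of scalars, let $\vec\alpha\in U_m$, and let $1<p_1,\dots,p_m<\infty$ with $\sum_{j=1}^m\frac1{p_j}=\frac1r$. Then $T_\epsilon^{\vec\alpha}$ is bounded from $L^{p_1}\times\cdots\times L^{p_m}$ to $L^r$ if and only if $\|\epsilon\|_\infty:=\sup_{I\in\mathcal{D}}|\epsilon_I|<\infty$. Moreover, if $\|\epsilon\|_\infty<\infty$, then $T_\epsilon^{\vec\alpha}$ is bounded from $L^{p_1}\times\cdots\times L^{p_m}$ to $L^{r,\infty}$ whenever $1\le p_1,\dots,p_m<\infty$ and $\sum_j\frac1{p_j}=\frac1r$.
   Context: $\mathcal{D}=\{[k2^{-n},(k+1)2^{-n}):k,n\in\mathbb{Z}\}$ is the standard dyadic grid on $\mathbb{R}$. For $I\in\mathcal{D}$ with left and right halves $I_-,I_+$, the Haar function is $h_I=|I|^{-1/2}(\mathbf{1}_{I_+}-\mathbf{1}_{I_-})$, and $h_I^k$ denotes its pointwise $k$-th power. $\langle f,g\rangle=\int_{\mathbb{R}}fg$ and $\langle f\rangle_I=\frac{1}{|I|}\int_I f$. For a function $f$ and $I\in\mathcal{D}$: $f(I,0)=\langle f,h_I\rangle$ and $f(I,1)=\langle f\rangle_I$. For $\vec\alpha\in\{0,1\}^m$, $\sigma(\vec\alpha)=\#\{j:\alpha_j=0\}$, and $U_m=\{0,1\}^m\setminus\{(1,\dots,1)\}$. The $m$-linear Haar multiplier with symbol $\epsilon$ is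 $T_\epsilon^{\vec\alpha}(f_1,\dots,f_m)=\sum_{I\in\mathcal{D}}\epsilon_I\Big(\prod_{j=1}^m f_j(I,\alpha_j)\Big)h_I^{\sigma(\vec\alpha)}$. $L^{s,\infty}$ is the weak $L^s$ space with quasinorm $\sup_{t>0}t|\{|f|>t\}|^{1/s}$. An $m$-linear operator $T$ is bounded from $X_1\times\cdots\times X_m$ to $Y$ if $\|T(f_1,\dots,f_m)\|_Y\le C\prod_j\|f_j\|_{X_j}$ for all $f_j\in X_j$. *)

theory Defs
  imports "HOL-Analysis.Analysis"
begin

text \<open>Dyadic intervals are indexed by pairs (n,k) of integers:
  (n,k) stands for the interval [k 2^(-n), (k+1) 2^(-n)).  This indexing is a bijection
  between int \<times> int and the standard dyadic grid D.\<close>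

definition dint :: "int \<times> int \<Rightarrow> real set" where
  "dint I = (case I of (n, k) \<Rightarrow>
     {real_of_int k * 2 powr (- real_of_int n) ..< (real_of_int k + 1) * 2 powr (- real_of_int n)})"

definition dlen :: "int \<times> int \<Rightarrow> real" where
  "dlen I = (case I of (n, k) \<Rightarrow> 2 powr (- real_of_int n))"

definition dleft :: "int \<times> int \<Rightarrow> real set" where
  "dleft I = (case I of (n, k) \<Rightarrow> dint (n + 1, 2 * k))"

definition dright :: "int \<times> int \<Rightarrow> real set" where
  "dright I = (case I of (n, k) \<Rightarrow> dint (n + 1, 2 * k + 1))"

definition haar :: "int \<times> int \<Rightarrow> real \<Rightarrow> real" where
  "haar I x = dlen I powr (-1/2) * (indicator (dright I) x - indicator (dleft I) x)"

definition coef :: "(real \<Rightarrow> real) \<Rightarrow> int \<times> int \<Rightarrow> nat \<Rightarrow> real" where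
  "coef f I a = (if a = 0 then (\<integral>x. f x * haar I x \<partial>lebesgue)
                 else (LINT x:dint I|lebesgue. f x) / dlen I)"

definition sigma :: "nat list \<Rightarrow> nat" where
  "sigma \<alpha> = length (filter (\<lambda>a. a = 0) \<alpha>)"

definition U :: "nat \<Rightarrow> nat list set" where
  "U m = {\<alpha>. length \<alpha> = m \<and> set \<alpha> \<subseteq> {0, 1}} - {replicate m 1}"

definition haar_term ::
  "(int \<times> int \<Rightarrow> real) \<Rightarrow> nat list \<Rightarrow> (nat \<Rightarrow> real \<Rightarrow> real) \<Rightarrow> int \<times> int \<Rightarrow> real \<Rightarrow> real" where
  "haar_term \<epsilon> \<alpha> f I x =
     \<epsilon> I * (\<Prod>j<length \<alpha>. coef (f j) I (\<alpha> ! j)) * (haar I x) ^ sigma \<alpha>"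

text \<open>The m-linear Haar multiplier: the sum over all dyadic intervals, understood as the
  pointwise limit of the partial sums over the scales |I| = 2^(-n), -N \<le> n \<le> N
  (for fixed scale and fixed x at most one summand is nonzero).\<close>
definition haar_mult ::
  "(int \<times> int \<Rightarrow> real) \<Rightarrow> nat list \<Rightarrow> (nat \<Rightarrow> real \<Rightarrow> real) \<Rightarrow> real \<Rightarrow> real" where
  "haar_mult \<epsilon> \<alpha> f x =
     lim (\<lambda>N::nat. \<Sum>n\<in>{- int N .. int N}. (\<Sum>\<^sub>\<infinity>k::int. haar_term \<epsilon> \<alpha> f (n, k) x))"

definition memLp :: "real \<Rightarrow> (real \<Rightarrow> real) \<Rightarrow> bool" where
  "memLp p f \<longleftrightarrow> f \<in> borel_measurable lebesgue \<and> integrable lebesgue (\<lambda>x. \<bar>f x\<bar> powr p)"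

definition Lp_norm :: "real \<Rightarrow> (real \<Rightarrow> real) \<Rightarrow> real" where
  "Lp_norm p f = (\<integral>x. \<bar>f x\<bar> powr p \<partial>lebesgue) powr (1 / p)"

definition weak_Lp_le :: "real \<Rightarrow> (real \<Rightarrow> real) \<Rightarrow> real \<Rightarrow> bool" where
  "weak_Lp_le r g c \<longleftrightarrow> g \<in> borel_measurable lebesgue \<and>
     (\<forall>t>0. emeasure lebesgue {x. t < \<bar>g x\<bar>} < \<infinity> \<and>
            t * measure lebesgue {x. t < \<bar>g x\<bar>} powr (1 / r) \<le> c)"

definition bounded_strong ::
  "(int \<times> int \<Rightarrow> real) \<Rightarrow> nat list \<Rightarrow> (nat \<Rightarrow> real) \<Rightarrow> real \<Rightarrow> bool" where
  "bounded_strong \<epsilon> \<alpha> p r \<longleftrightarrow> (\<exists>C. \<forall>f. (\<forall>j<length \<alpha>. memLp (p j) (f j)) \<longrightarrow>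
      memLp r (haar_mult \<epsilon> \<alpha> f) \<and>
      Lp_norm r (haar_mult \<epsilon> \<alpha> f) \<le> C * (\<Prod>j<length \<alpha>. Lp_norm (p j) (f j)))"

definition bounded_weak ::
  "(int \<times> int \<Rightarrow> real) \<Rightarrow> nat list \<Rightarrow> (nat \<Rightarrow> real) \<Rightarrow> real \<Rightarrow> bool" where
  "bounded_weak \<epsilon> \<alpha> p r \<longleftrightarrow> (\<exists>C. \<forall>f. (\<forall>j<length \<alpha>. memLp (p j) (f j)) \<longrightarrow>
      weak_Lp_le r (haar_mult \<epsilon> \<alpha> f) (C * (\<Prod>j<length \<alpha>. Lp_norm (p j) (f j))))"

end

theory Submission
  imports Defs
begin

text \<open>
  On the interval \<open>I\<close> the multiplier has the summand \<open>c I\<close> times \<open>1\<close> on the right half and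
  \<open>(-1) ^ \<sigma>\<close> on the left half, where \<open>c I\<close> is \<open>\<epsilon> I\<close> times a product of averages and half-differences of
  averages of the \<open>f j\<close>. As long as the averages of \<open>\<bar>f j\<bar>\<close> stay below thresholds \<open>H j\<close>, the energies
  \<open>\<bar>c I\<bar> ^ q\<close> (\<open>q = 2\<close> for odd \<open>\<sigma>\<close>, \<open>q = 1\<close> for even \<open>\<sigma>\<close>) telescope, so Kolmogorov's
  inequality controls the maximal partial sums. This yields the good-lambda inequality
  \<open>|{T\<^sup>* > 2t}| \<le> \<delta> |{T\<^sup>* > t}| + \<Sum>j. |{M (f j) > H j}|\<close> with \<open>\<Prod>j. H j = \<gamma> t\<close> and \<open>\<delta>\<close> as small as we
  like. Iterating it over \<open>t\<close>, the dyadic maximal theorem gives the weak bounds for \<open>p j \<ge> 1\<close> and the strong bounds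
  for \<open>p j > 1\<close> on finite trees, and Fatou's lemma removes the truncation. Convergence almost everywhere follows at fine
  scales from the summability of the energies and at coarse scales from the decay
  \<open>\<bar>c I\<bar> \<le> C * |I| powr (- 1 / r)\<close>. Conversely, testing on \<open>h\<^sub>I\<close> and the indicator of \<open>I\<close> isolates the single term
  with \<open>\<epsilon> I\<close>.
\<close>

section \<open>Dyadic intervals and averages\<close>

text \<open>The exponent \<open>r\<close> may be smaller than 1, so neither duality nor a triangle
  inequality in L^r is at hand; the estimates are therefore made on distribution functions.
  Truncating to a finite tree below one interval makes the absorption in the iterations legitimate:
  level sets there have measure at most the length of the interval, and this bound drops out in the
  end. The parity of sigma decides the choice of \<open>q\<close>. For odd sigma the function
  h_I^sigma has mean zero, the path sums form a martingale, and orthogonality lets one squared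
  oscillation factor suffice. For even sigma it is non-negative and nothing cancels, so absolute
  sums have to be controlled; in return at least two oscillation factors are present and their
  product is summable. \<open>haar_mult\<close> is a pointwise \<open>lim\<close>, whose value says
  nothing where the partial sums diverge. Convergence almost everywhere is therefore needed before
  Fatou's lemma can carry any bound over to the multiplier.\<close>

definition left_child :: "int \<times> int \<Rightarrow> int \<times> int" where
  "left_child I = (fst I + 1, 2 * snd I)"

definition right_child :: "int \<times> int \<Rightarrow> int \<times> int" where
  "right_child I = (fst I + 1, 2 * snd I + 1)"

definition dyad :: "int \<Rightarrow> real \<Rightarrow> int \<times> int" where
  "dyad n x = (n, \<lfloor>x * 2 powr real_of_int n\<rfloor>)"

lemma fst_child [simp]: "fst (left_child I) = fst I + 1" "fst (right_child I) = fst I + 1"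
  by (auto simp: left_child_def right_child_def)

lemma fst_dyad [simp]: "fst (dyad n x) = n"
  by (simp add: dyad_def)

lemma dlen_eq: "dlen I = 2 powr (- real_of_int (fst I))"
  by (simp add: dlen_def split_beta)

lemma dlen_pos [simp]: "dlen I > 0"
  by (simp add: dlen_eq)

lemma dlen_nonneg [simp]: "0 \<le> dlen I" and dlen_nonzero [simp]: "dlen I \<noteq> 0"
  and abs_dlen [simp]: "\<bar>dlen I\<bar> = dlen I"
  by (simp_all add: dlen_eq)

lemma dlen_child [simp]: "dlen (left_child I) = dlen I / 2" "dlen (right_child I) = dlen I / 2"
  by (simp_all add: dlen_eq powr_diff powr_minus powr_add divide_simps)

text \<open>With membership written as an equation for \<open>dyad\<close>, disjointness within a
  generation and the path of a point through the tree need no interval arithmetic.\<close>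

lemma mem_dint_iff: "x \<in> dint I \<longleftrightarrow> dyad (fst I) x = I"
proof (cases I)
  case (Pair n k)
  have "x \<in> dint (n, k) \<longleftrightarrow> \<lfloor>x * 2 powr real_of_int n\<rfloor> = k"
    by (auto simp: dint_def floor_eq_iff powr_minus field_simps)
  thus ?thesis
    by (simp add: Pair dyad_def)
qed

lemma mem_dint_dyad [simp]: "x \<in> dint (dyad n x)"
  by (simp add: mem_dint_iff)

lemma dint_children: "dint I = dint (left_child I) \<union> dint (right_child I)"
  and dint_children_disjoint: "dint (left_child I) \<inter> dint (right_child I) = {}"
proof -
  obtain n k where I: "I = (n, k)" by (cases I)
  have *: "2 powr (- real_of_int (n + 1)) = 2 powr (- real_of_int n) / 2"
    using dlen_child(1)[of I] by (simp add: dlen_eq I)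
  define h :: real where "h = 2 powr (- real_of_int n) / 2"
  have h: "h > 0" by (simp add: h_def)
  have 1: "2 powr (- real_of_int n) = 2 * h" by (simp add: h_def)
  have L: "dint (left_child I) = {2 * real_of_int k * h ..< (2 * real_of_int k + 1) * h}"
    unfolding dint_def left_child_def I prod.case fst_conv snd_conv * 1 by simp
  have R: "dint (right_child I) = {(2 * real_of_int k + 1) * h ..< (2 * real_of_int k + 2) * h}"
    unfolding dint_def right_child_def I prod.case fst_conv snd_conv * 1 by (simp add: add_ac)
  have D: "dint I = {2 * real_of_int k * h ..< (2 * real_of_int k + 2) * h}"
    unfolding dint_def I prod.case 1 by (simp add: algebra_simps)
  show "dint I = dint (left_child I) \<union> dint (right_child I)" "dint (left_child I) \<inter> dint (right_child I) = {}"
    unfolding L R D using h by (auto simp: algebra_simps)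
qed

lemma dleft_eq: "dleft I = dint (left_child I)" and dright_eq: "dright I = dint (right_child I)"
  by (simp_all add: dleft_def dright_def left_child_def right_child_def split_beta)

lemma dint_sets [measurable]: "dint I \<in> sets borel" "dint I \<in> sets lebesgue"
  by (simp_all add: dint_def split_beta)

lemma emeasure_dint: "emeasure lebesgue (dint I) = ennreal (dlen I)"
  by (simp add: dint_def dlen_def split_beta algebra_simps)

lemma measure_dint [simp]: "measure lebesgue (dint I) = dlen I"
  using dlen_pos[of I] by (simp add: measure_def emeasure_dint)

lemma measure_lborel_dint [simp]: "measure lborel (dint I) = dlen I"
  using measure_dint[of I] by (simp del: measure_dint)

lemma dint_lmeasurable: "dint I \<in> lmeasurable"
  by (rule fmeasurableI) (auto simp: emeasure_dint)

definition avg :: "(real \<Rightarrow> real) \<Rightarrow> int \<times> int \<Rightarrow> real" where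
  "avg f I = (LINT x:dint I|lebesgue. f x) / dlen I"

text \<open>The Haar coefficient freed of its factor |I|^(1/2), see \<open>coef_0\<close>. In this
  normalisation oscillations and averages obey the same bound by the average of |f|.\<close>

definition osc :: "(real \<Rightarrow> real) \<Rightarrow> int \<times> int \<Rightarrow> real" where
  "osc f I = (avg f (right_child I) - avg f (left_child I)) / 2"

definition locint :: "(real \<Rightarrow> real) \<Rightarrow> bool" where
  "locint f \<longleftrightarrow> (\<forall>I. set_integrable lebesgue (dint I) f)"

lemma locintD: "locint f \<Longrightarrow> set_integrable lebesgue (dint I) f"
  unfolding locint_def by blast

lemma locint_abs: "locint f \<Longrightarrow> locint (\<lambda>x. \<bar>f x\<bar>)"
  by (auto simp: locint_def intro: set_integrable_abs)

lemma avg_children: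
  assumes "locint f"
  shows "avg f I = (avg f (left_child I) + avg f (right_child I)) / 2"
proof -
  have "(LINT x:dint I|lebesgue. f x) =
      (LINT x:dint (left_child I)|lebesgue. f x) + (LINT x:dint (right_child I)|lebesgue. f x)"
    unfolding dint_children[of I]
    by (rule set_integral_Un) (use assms dint_children_disjoint in \<open>simp_all add: locintD\<close>)
  thus ?thesis
    by (simp add: avg_def add_divide_distrib)
qed

lemma abs_avg_le: "\<bar>avg f I\<bar> \<le> avg (\<lambda>x. \<bar>f x\<bar>) I"
proof -
  have "\<bar>LINT x:dint I|lebesgue. f x\<bar> \<le> (LINT x:dint I|lebesgue. \<bar>f x\<bar>)"
    unfolding set_lebesgue_integral_def
    by (rule order_trans[OF integral_abs_bound]) (simp add: abs_mult)
  thus ?thesis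
    by (simp add: avg_def divide_right_mono)
qed

lemma avg_abs_nonneg: "0 \<le> avg (\<lambda>x. \<bar>f x\<bar>) I"
  using abs_avg_le[of f I] by linarith

lemma abs_osc_le:
  assumes "locint f"
  shows "\<bar>osc f I\<bar> \<le> avg (\<lambda>x. \<bar>f x\<bar>) I"
  using abs_avg_le[of f "left_child I"] abs_avg_le[of f "right_child I"] avg_children[OF locint_abs[OF assms], of I]
  unfolding osc_def abs_divide by simp

lemma coef_0:
  assumes "locint f"
  shows "coef f I 0 = dlen I powr (1/2) * osc f I"
proof -
  have i: "integrable lebesgue (\<lambda>x. indicator (dint J) x * f x)" for J
    using locintD[OF assms, of J] by (simp add: set_integrable_def)
  have "coef f I 0 = (\<integral>x. dlen I powr (-1/2) *
      (indicator (dint (right_child I)) x * f x - indicator (dint (left_child I)) x * f x) \<partial>lebesgue)"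
    unfolding coef_def haar_def dleft_eq dright_eq
    by (auto intro!: Bochner_Integration.integral_cong simp: algebra_simps)
  also have "\<dots> = dlen I powr (-1/2) * ((LINT x:dint (right_child I)|lebesgue. f x) -
      (LINT x:dint (left_child I)|lebesgue. f x))"
    using i[of "right_child I"] i[of "left_child I"] by (simp add: set_lebesgue_integral_def)
  also have "\<dots> = dlen I powr (-1/2) * dlen I * osc f I"
    using dlen_pos[of I] by (simp add: osc_def avg_def field_simps)
  also have "dlen I powr (-1/2) * dlen I = dlen I powr (1/2)"
    using powr_add[of "dlen I" "-1/2" 1] by simp
  finally show ?thesis .
qed

lemma haar_power:
  assumes "x \<in> dint I"
  shows "haar I x ^ s = dlen I powr (- real s / 2) * (if x \<in> dint (right_child I) then 1 else (-1) ^ s)"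
proof -
  have "dlen I powr (- real s / 2) = (dlen I powr (-1/2)) ^ s"
    by (subst powr_power) auto
  moreover have "haar I x = dlen I powr (-1/2) * (if x \<in> dint (right_child I) then 1 else -1)"
    using assms dint_children[of I] dint_children_disjoint[of I]
    by (auto simp: haar_def dleft_eq dright_eq indicator_def)
  ultimately show ?thesis
    by (simp add: power_mult_distrib)
qed

lemma haar_outside: "x \<notin> dint I \<Longrightarrow> haar I x = 0"
  using dint_children[of I] by (auto simp: haar_def dleft_eq dright_eq)

section \<open>Path sums on the dyadic tree\<close>

text \<open>The factor \<open>e\<close> is returned outside \<open>dint I\<close> as well; path sums
  evaluate the term only at \<open>dyad n x\<close>, which contains \<open>x\<close>.\<close>

definition branch_term :: "(int \<times> int \<Rightarrow> real) \<Rightarrow> real \<Rightarrow> int \<times> int \<Rightarrow> real \<Rightarrow> real" where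
  "branch_term c e I x = c I * (if x \<in> dint (right_child I) then 1 else e)"

definition path_sum :: "(int \<times> int \<Rightarrow> real) \<Rightarrow> real \<Rightarrow> nat \<Rightarrow> int \<Rightarrow> real \<Rightarrow> real" where
  "path_sum c e i n x = (\<Sum>l<i. branch_term c e (dyad (n + int l) x) x)"

lemma path_sum_0 [simp]: "path_sum c e 0 n x = 0"
  by (simp add: path_sum_def)

lemma path_sum_Suc: "path_sum c e (Suc i) n x = branch_term c e (dyad n x) x + path_sum c e i (n + 1) x"
  unfolding path_sum_def sum.lessThan_Suc_shift by (simp add: add_ac)

lemma path_sum_add: "path_sum c e (i + k) n x = path_sum c e i n x + path_sum c e k (n + int i) x"
  by (induction i arbitrary: n) (simp_all add: path_sum_Suc add_ac)

text \<open>Characterised in \<open>mem_exceed_set\<close>; the recursion over the two halves is what makes all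
  estimates below provable by induction from the finest scale upwards.\<close>

primrec exceed_set :: "(int \<times> int \<Rightarrow> real) \<Rightarrow> real \<Rightarrow> (int \<times> int \<Rightarrow> bool) \<Rightarrow> real \<Rightarrow> nat \<Rightarrow>
    int \<times> int \<Rightarrow> real \<Rightarrow> real set" where
  "exceed_set c e g s 0 I u = (if s < \<bar>u\<bar> then dint I else {})"
| "exceed_set c e g s (Suc N) I u = (if s < \<bar>u\<bar> then dint I else if g I then
     exceed_set c e g s N (left_child I) (u + e * c I) \<union> exceed_set c e g s N (right_child I) (u + c I) else {})"

lemma exceed_set_subset: "exceed_set c e g s N I u \<subseteq> dint I"
proof (induction N arbitrary: I u)
  case (Suc N)
  show ?case using Suc[of "left_child I" "u + e * c I"] Suc[of "right_child I" "u + c I"] dint_children[of I]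
    by (simp del: Un_subset_iff) blast
qed simp

lemma exceed_set_lmeasurable: "exceed_set c e g s N I u \<in> lmeasurable"
  by (induction N arbitrary: I u) (simp_all add: dint_lmeasurable fmeasurable.Un)

lemma measure_children_Un:
  assumes "A \<in> lmeasurable" "B \<in> lmeasurable" "A \<subseteq> dint (left_child I)" "B \<subseteq> dint (right_child I)"
  shows "measure lebesgue (A \<union> B) = measure lebesgue A + measure lebesgue B"
proof -
  have "A \<inter> B = {}" using assms(3,4) dint_children_disjoint[of I] by blast
  thus ?thesis using measure_Un3[OF assms(1,2)] by simp
qed

lemma measure_exceed_set_Suc:
  assumes "\<not> s < \<bar>u\<bar>" "g I"
  shows "measure lebesgue (exceed_set c e g s (Suc N) I u) =
    measure lebesgue (exceed_set c e g s N (left_child I) (u + e * c I)) +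
    measure lebesgue (exceed_set c e g s N (right_child I) (u + c I))"
  using assms measure_children_Un[OF exceed_set_lmeasurable exceed_set_lmeasurable exceed_set_subset exceed_set_subset]
  by simp

lemma measure_exceed_set_le: "measure lebesgue (exceed_set c e g s N I u) \<le> dlen I"
  using measure_mono_fmeasurable[OF exceed_set_subset fmeasurableD[OF exceed_set_lmeasurable] dint_lmeasurable]
  by simp

lemma ex_le_Suc: "(\<exists>i\<le>Suc N. P i) \<longleftrightarrow> P 0 \<or> (\<exists>i\<le>N. P (Suc i))"
  by (metis Suc_le_mono le0 not0_implies_Suc)

text \<open>The guard is demanded for \<open>l < i\<close> only, that is, for the intervals whose
  coefficients have entered the sum. The interval at which the level is passed may itself be
  bad.\<close>

lemma mem_exceed_set:
  assumes "x \<in> dint I"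
  shows "x \<in> exceed_set c e g s N I u \<longleftrightarrow>
    (\<exists>i\<le>N. s < \<bar>u + path_sum c e i (fst I) x\<bar> \<and> (\<forall>l<i. g (dyad (fst I + int l) x)))"
  using assms
proof (induction N arbitrary: I u)
  case (Suc N)
  have I: "dyad (fst I) x = I"
    using Suc.prems by (simp add: mem_dint_iff)
  have *: "(\<exists>i\<le>N. s < \<bar>u + path_sum c e (Suc i) (fst I) x\<bar> \<and> (\<forall>l<Suc i. g (dyad (fst I + int l) x)))
    \<longleftrightarrow> g I \<and> (\<exists>i\<le>N. s < \<bar>u + branch_term c e I x + path_sum c e i (fst I + 1) x\<bar> \<and>
            (\<forall>l<i. g (dyad (fst I + 1 + int l) x)))"
    unfolding All_less_Suc2 path_sum_Suc I by (auto simp: I add_ac)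
  consider "x \<in> dint (left_child I)" "x \<notin> dint (right_child I)" | "x \<in> dint (right_child I)" "x \<notin> dint (left_child I)"
    using Suc.prems dint_children[of I] dint_children_disjoint[of I] by blast
  thus ?case
  proof cases
    case 1
    have "x \<in> exceed_set c e g s (Suc N) I u \<longleftrightarrow>
        s < \<bar>u\<bar> \<or> g I \<and> x \<in> exceed_set c e g s N (left_child I) (u + e * c I)"
      using 1 Suc.prems exceed_set_subset[of c e g s N "right_child I"] by auto
    thus ?thesis
      unfolding ex_le_Suc * using 1 Suc.IH[OF 1(1)] by (simp add: branch_term_def mult.commute)
  next
    case 2
    have "x \<in> exceed_set c e g s (Suc N) I u \<longleftrightarrow>
        s < \<bar>u\<bar> \<or> g I \<and> x \<in> exceed_set c e g s N (right_child I) (u + c I)"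
      using 2 Suc.prems exceed_set_subset[of c e g s N "left_child I"] by auto
    thus ?thesis
      unfolding ex_le_Suc * using 2 Suc.IH[OF 2(1)] by (simp add: branch_term_def)
  qed
qed auto

text \<open>The integral over \<open>I\<close> of the sum of \<open>w\<close> along the first
  \<open>N\<close> intervals of a path, stopped at the first one violating \<open>g\<close>. For
  squared coefficients and \<open>e = -1\<close> this is the squared L^2 norm of the stopped
  martingale.\<close>

primrec tree_energy :: "(int \<times> int \<Rightarrow> real) \<Rightarrow> (int \<times> int \<Rightarrow> bool) \<Rightarrow> nat \<Rightarrow> int \<times> int \<Rightarrow> real" where
  "tree_energy w g 0 I = 0"
| "tree_energy w g (Suc N) I =
     (if g I then dlen I * w I + tree_energy w g N (left_child I) + tree_energy w g N (right_child I) else 0)"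

lemma tree_energy_nonneg: "(\<And>I. 0 \<le> w I) \<Longrightarrow> 0 \<le> tree_energy w g N I"
  by (induction N arbitrary: I) auto

lemma tree_energy_mono_Suc: "(\<And>I. 0 \<le> w I) \<Longrightarrow> tree_energy w g N I \<le> tree_energy w g (Suc N) I"
proof (induction N arbitrary: I)
  case (Suc N)
  show ?case
    using Suc.IH[OF Suc.prems, of "left_child I"] Suc.IH[OF Suc.prems, of "right_child I"]
    unfolding tree_energy.simps(2)[of w g "Suc N" I] tree_energy.simps(2)[of w g N I] by simp
qed simp

text \<open>Kolmogorov's maximal inequality. It is used with \<open>q = 2\<close>, \<open>e = -1\<close> (martingale differences) and with
  \<open>q = 1\<close>, \<open>e = 1\<close> (absolute sums).\<close>

lemma measure_exceed_set_le_tree_energy: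
  assumes e: "\<And>u v. \<bar>u + e * v\<bar> ^ q + \<bar>u + v\<bar> ^ q \<le> 2 * (\<bar>u\<bar> ^ q + \<bar>v\<bar> ^ q)" and s: "0 \<le> s"
  shows "s ^ q * measure lebesgue (exceed_set c e g s N I u) \<le>
    dlen I * \<bar>u\<bar> ^ q + tree_energy (\<lambda>I. \<bar>c I\<bar> ^ q) g N I"
proof (induction N arbitrary: I u)
  case 0
  show ?case using s power_mono[of s "\<bar>u\<bar>" q] by (auto simp: mult.commute[of _ "dlen I"] intro!: mult_left_mono)
next
  case (Suc N)
  have nn: "0 \<le> tree_energy (\<lambda>I. \<bar>c I\<bar> ^ q) g N I" for N I
    by (rule tree_energy_nonneg) simp
  consider "s < \<bar>u\<bar>" | "\<not> s < \<bar>u\<bar>" "g I" | "\<not> s < \<bar>u\<bar>" "\<not> g I"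
    by blast
  thus ?case
  proof cases
    case 1
    have "s ^ q * dlen I \<le> \<bar>u\<bar> ^ q * dlen I"
      using 1 s by (intro mult_right_mono power_mono) auto
    moreover have "measure lebesgue (exceed_set c e g s (Suc N) I u) = dlen I" using 1 by simp
    ultimately show ?thesis
      using nn[of "Suc N" I] by (simp only: mult.commute[of "dlen I"])
  next
    case 2
    have "s ^ q * measure lebesgue (exceed_set c e g s (Suc N) I u) \<le>
       (dlen I / 2) * (\<bar>u + e * c I\<bar> ^ q + \<bar>u + c I\<bar> ^ q) + tree_energy (\<lambda>I. \<bar>c I\<bar> ^ q) g N (left_child I) +
         tree_energy (\<lambda>I. \<bar>c I\<bar> ^ q) g N (right_child I)"
      using Suc[of "left_child I" "u + e * c I"] Suc[of "right_child I" "u + c I"]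
      unfolding measure_exceed_set_Suc[where g=g, OF 2] by (simp add: algebra_simps)
    also have "(dlen I / 2) * (\<bar>u + e * c I\<bar> ^ q + \<bar>u + c I\<bar> ^ q) \<le>
        (dlen I / 2) * (2 * (\<bar>u\<bar> ^ q + \<bar>c I\<bar> ^ q))"
      by (intro mult_left_mono e) simp
    finally show ?thesis using 2 by (simp add: algebra_simps)
  qed simp
qed

text \<open>Descends \<open>i\<close> good generations without accumulating anything and then
  restarts from 0. It thus records how far the path sums move after those generations, which is the
  oscillation in Cauchy's criterion.\<close>

primrec tail_exceed_set :: "(int \<times> int \<Rightarrow> real) \<Rightarrow> real \<Rightarrow> (int \<times> int \<Rightarrow> bool) \<Rightarrow> real \<Rightarrow> nat \<Rightarrow> nat \<Rightarrow>
    int \<times> int \<Rightarrow> real set" where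
  "tail_exceed_set c e g s 0 N I = exceed_set c e g s N I 0"
| "tail_exceed_set c e g s (Suc i) N I =
     (if g I then tail_exceed_set c e g s i N (left_child I) \<union> tail_exceed_set c e g s i N (right_child I) else {})"

lemma tail_exceed_set_subset: "tail_exceed_set c e g s i N I \<subseteq> dint I"
proof (induction i arbitrary: I)
  case 0 thus ?case using exceed_set_subset by simp
next
  case (Suc i)
  show ?case using Suc[of "left_child I"] Suc[of "right_child I"] dint_children[of I] by auto
qed

lemma tail_exceed_set_lmeasurable: "tail_exceed_set c e g s i N I \<in> lmeasurable"
  by (induction i arbitrary: I) (simp_all add: exceed_set_lmeasurable fmeasurable.Un)

lemma mem_tail_exceed_set:
  assumes "x \<in> dint I" "\<And>l. l < i \<Longrightarrow> g (dyad (fst I + int l) x)"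
    "x \<in> exceed_set c e g s N (dyad (fst I + int i) x) 0"
  shows "x \<in> tail_exceed_set c e g s i N I"
  using assms
proof (induction i arbitrary: I)
  case 0
  thus ?case by (simp add: mem_dint_iff)
next
  case (Suc i)
  have g: "g I" using Suc.prems(2)[of 0] Suc.prems(1) by (simp add: mem_dint_iff)
  have *: "x \<in> tail_exceed_set c e g s i N J" if "x \<in> dint J" "fst J = fst I + 1" for J
    using Suc.prems(2)[of "Suc _"] Suc.prems(3) that by (intro Suc.IH) (auto simp: add_ac)
  show ?case
    using *[of "left_child I"] *[of "right_child I"] g Suc.prems(1) dint_children[of I] by auto
qed

lemma tail_exceed_set_mono: "N \<le> N' \<Longrightarrow> tail_exceed_set c e g s i N I \<subseteq> tail_exceed_set c e g s i N' I"
proof (induction i arbitrary: I)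
  case 0
  show ?case
  proof
    fix x assume x: "x \<in> tail_exceed_set c e g s 0 N I"
    hence "x \<in> dint I" using tail_exceed_set_subset by blast
    with x 0 show "x \<in> tail_exceed_set c e g s 0 N' I"
      by (simp add: mem_exceed_set) (meson order_trans)
  qed
next
  case (Suc i)
  show ?case using Suc.IH[OF Suc.prems, of "left_child I"] Suc.IH[OF Suc.prems, of "right_child I"] by auto
qed

text \<open>The two energies share their first \<open>i\<close> generations, so the difference is
  the energy of the later ones. Once energies are bounded it tends to 0 in \<open>i\<close>,
  uniformly in \<open>N\<close>.\<close>

lemma measure_tail_exceed_set_le:
  assumes e: "\<And>u v. \<bar>u + e * v\<bar> ^ q + \<bar>u + v\<bar> ^ q \<le> 2 * (\<bar>u\<bar> ^ q + \<bar>v\<bar> ^ q)" and s: "0 \<le> s"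
    and q: "q \<noteq> 0"
  shows "s ^ q * measure lebesgue (tail_exceed_set c e g s i N I) \<le>
    tree_energy (\<lambda>I. \<bar>c I\<bar> ^ q) g (N + i) I - tree_energy (\<lambda>I. \<bar>c I\<bar> ^ q) g i I"
proof (induction i arbitrary: I)
  case 0
  show ?case using measure_exceed_set_le_tree_energy[OF e s, of c g N I 0] q by (simp add: power_0_left)
next
  case (Suc i)
  show ?case
  proof (cases "g I")
    case True
    have "measure lebesgue (tail_exceed_set c e g s (Suc i) N I) =
        measure lebesgue (tail_exceed_set c e g s i N (left_child I)) + measure lebesgue (tail_exceed_set c e g s i N (right_child I))"
      using True measure_children_Un[OF tail_exceed_set_lmeasurable tail_exceed_set_lmeasurable tail_exceed_set_subset tail_exceed_set_subset]
      by simp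
    thus ?thesis using True Suc[of "left_child I"] Suc[of "right_child I"] by (simp add: algebra_simps)
  qed simp
qed

text \<open>A new starting value shifts all later sums by the same amount, so the level has to drop
  by no more than this shift. If the new value exceeds \<open>s'\<close> at once, the right-hand set
  is all of \<open>dint I\<close>.\<close>

lemma exceed_set_shift_subset:
  assumes "s' + \<bar>u - u'\<bar> \<le> s"
  shows "exceed_set c e g s N I u \<subseteq> exceed_set c e g s' N I u'"
  using assms
proof (induction N arbitrary: I u u')
  case (Suc N)
  show ?case
  proof (cases "s' < \<bar>u'\<bar>")
    case True
    thus ?thesis using exceed_set_subset[of c e g s "Suc N" I u] by simp
  next
    case False
    hence "\<not> s < \<bar>u\<bar>" using Suc.prems by linarith
    moreover have "exceed_set c e g s N J (u + d) \<subseteq> exceed_set c e g s' N J (u' + d)" for J d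
      using Suc.prems by (intro Suc.IH) simp
    ultimately show ?thesis using False by (simp del: Un_subset_iff) blast
  qed
qed auto

text \<open>Stop where the sum first passes \<open>t\<close>. The last step is at most
  \<open>t/2\<close>, so the sum is then at most \<open>3/2 * t\<close>, and passing
  \<open>2*t\<close> needs a further move of more than \<open>t/2\<close>, which hypothesis
  \<open>d\<close> allows only on a fraction \<open>d\<close> of the stopping interval. That
  interval lies entirely in the level set for \<open>t\<close>, and the induction adds up these
  contributions.\<close>

lemma good_lambda:
  assumes d: "\<And>N I. measure lebesgue (exceed_set c e g (t/2) N I 0) \<le> d * dlen I"
    and c: "\<And>I. g I \<Longrightarrow> \<bar>c I\<bar> \<le> t / 2" and e: "\<bar>e\<bar> = 1" and d0: "0 \<le> d" and u: "\<bar>u\<bar> \<le> t"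
    and t: "0 < t"
  shows "measure lebesgue (exceed_set c e g (2*t) N I u) \<le>
    d * measure lebesgue (exceed_set c e (\<lambda>_. True) t N I u)"
  using u
proof (induction N arbitrary: I u)
  case 0
  thus ?case using d0 t by auto
next
  case (Suc N)
  show ?case
  proof (cases "g I")
    case True
    have *: "measure lebesgue (exceed_set c e g (2*t) N J v) \<le>
        d * measure lebesgue (exceed_set c e (\<lambda>_. True) t N J v)" if v: "\<bar>v\<bar> \<le> 3/2 * t" for J v
    proof (cases "\<bar>v\<bar> \<le> t")
      case False
      have "measure lebesgue (exceed_set c e g (2*t) N J v) \<le> measure lebesgue (exceed_set c e g (t/2) N J 0)"
        using v by (intro measure_mono_fmeasurable exceed_set_shift_subset fmeasurableD exceed_set_lmeasurable) auto
      also have "\<dots> \<le> d * dlen J" by (rule d)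
      also have "exceed_set c e (\<lambda>_. True) t N J v = dint J"
        using False by (cases N) auto
      hence "dlen J = measure lebesgue (exceed_set c e (\<lambda>_. True) t N J v)" by simp
      finally show ?thesis .
    qed (rule Suc.IH)
    have c': "\<bar>c I\<bar> \<le> t/2" using c True by simp
    have ec: "\<bar>e * c I\<bar> = \<bar>c I\<bar>" using e by (simp add: abs_mult)
    have 1: "\<bar>u + e * c I\<bar> \<le> 3/2 * t" "\<bar>u + c I\<bar> \<le> 3/2 * t"
      using Suc.prems c' ec by linarith+
    have 2: "\<not> 2 * t < \<bar>u\<bar>" "\<not> t < \<bar>u\<bar>" using Suc.prems t by auto
    show ?thesis
      unfolding measure_exceed_set_Suc[where g=g, OF 2(1) True] measure_exceed_set_Suc[where g="\<lambda>_. True", OF 2(2) TrueI]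
      using *[OF 1(1), of "left_child I"] *[OF 1(2), of "right_child I"] by (simp add: algebra_simps)
  qed (use Suc.prems t d0 in auto)
qed

section \<open>The dyadic maximal function and the energy estimate\<close>

primrec maximal_set :: "(int \<times> int \<Rightarrow> real) \<Rightarrow> real \<Rightarrow> nat \<Rightarrow> int \<times> int \<Rightarrow> real set" where
  "maximal_set A H 0 I = (if H < A I then dint I else {})"
| "maximal_set A H (Suc N) I = (if H < A I then dint I else maximal_set A H N (left_child I) \<union> maximal_set A H N (right_child I))"

lemma maximal_set_subset: "maximal_set A H N I \<subseteq> dint I"
proof (induction N arbitrary: I)
  case (Suc N)
  show ?case using Suc[of "left_child I"] Suc[of "right_child I"] dint_children[of I] by auto
qed simp

lemma maximal_set_lmeasurable: "maximal_set A H N I \<in> lmeasurable"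
  by (induction N arbitrary: I) (simp_all add: dint_lmeasurable fmeasurable.Un)

lemma mem_maximal_set:
  assumes "x \<in> dint I"
  shows "x \<in> maximal_set A H N I \<longleftrightarrow> (\<exists>i\<le>N. H < A (dyad (fst I + int i) x))"
  using assms
proof (induction N arbitrary: I)
  case 0
  thus ?case by (simp add: mem_dint_iff)
next
  case (Suc N)
  have I: "dyad (fst I) x = I"
    using Suc.prems by (simp add: mem_dint_iff)
  consider "x \<in> dint (left_child I)" "x \<notin> dint (right_child I)" | "x \<in> dint (right_child I)" "x \<notin> dint (left_child I)"
    using Suc.prems dint_children[of I] dint_children_disjoint[of I] by blast
  thus ?case
  proof cases
    case 1
    thus ?thesis unfolding ex_le_Suc using Suc.IH[OF 1(1)] Suc.prems I maximal_set_subset[of A H N "right_child I"]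
      by (auto simp: add_ac)
  next
    case 2
    thus ?thesis unfolding ex_le_Suc using Suc.IH[OF 2(1)] Suc.prems I maximal_set_subset[of A H N "left_child I"]
      by (auto simp: add_ac)
  qed
qed

text \<open>Weak type (1,1) with constant 1: the mass \<open>dlen I * A I\<close> is additive over
  the halves, and the recursion stops on disjoint intervals where \<open>A\<close> exceeds
  \<open>H\<close>. Keeping \<open>A\<close> abstract allows averages of |f|, of |f|^p and of
  truncations.\<close>

lemma measure_maximal_set_le:
  assumes A: "\<And>I. A I = (A (left_child I) + A (right_child I)) / 2" and A0: "\<And>I. 0 \<le> A I"
  shows "H * measure lebesgue (maximal_set A H N I) \<le> dlen I * A I"
proof (induction N arbitrary: I)
  case 0
  show ?case using A0[of I] by (simp add: mult.commute[of _ "dlen I"])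
next
  case (Suc N)
  show ?case
  proof (cases "H < A I")
    case False
    have "measure lebesgue (maximal_set A H (Suc N) I) =
        measure lebesgue (maximal_set A H N (left_child I)) + measure lebesgue (maximal_set A H N (right_child I))"
      using False measure_children_Un[OF maximal_set_lmeasurable maximal_set_lmeasurable maximal_set_subset maximal_set_subset]
      by simp
    hence "H * measure lebesgue (maximal_set A H (Suc N) I) \<le>
        dlen I / 2 * A (left_child I) + dlen I / 2 * A (right_child I)"
      using Suc[of "left_child I"] Suc[of "right_child I"] by (simp add: algebra_simps)
    also have "\<dots> = dlen I * A I" by (subst (3) A) (simp add: algebra_simps)
    finally show ?thesis .
  qed (simp add: mult.commute)
qed

lemma maximal_set_mono: "N \<le> N' \<Longrightarrow> maximal_set A H N I \<subseteq> maximal_set A H N' I"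
  by (meson maximal_set_subset mem_maximal_set order_trans subset_iff)

text \<open>The claim is stronger than needed so that it is inductive: the half-difference \<open>osc\<close> of the averages
  satisfies the energy identity \<open>2 (avg\<^sup>2 + osc\<^sup>2) =\<close> sum of the squared averages over the two halves, so the
  sum telescopes. Stopped intervals still have averages at most \<open>2 * H j\<close>, hence the constant 4.\<close>

lemma tree_energy_le:
  assumes f: "\<And>j. j < m \<Longrightarrow> locint (f j)" and H: "\<And>j. j < m \<Longrightarrow> 0 < H j"
    and g: "\<And>I j. g I \<Longrightarrow> j < m \<Longrightarrow> avg (\<lambda>x. \<bar>f j x\<bar>) I \<le> H j"
    and w: "\<And>I. g I \<Longrightarrow> w I \<le> D * (\<Sum>j<m. (osc (f j) I / H j)\<^sup>2)"
    and D: "0 \<le> D"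
    and I: "\<And>j. j < m \<Longrightarrow> avg (\<lambda>x. \<bar>f j x\<bar>) I \<le> 2 * H j"
  shows "tree_energy w g N I \<le> dlen I * (D * (\<Sum>j<m. 4 - (avg (f j) I / H j)\<^sup>2))"
  using I
proof (induction N arbitrary: I)
  case (0 I)
  have "(avg (f j) I / H j)\<^sup>2 \<le> 4" if "j < m" for j
  proof -
    have "\<bar>avg (f j) I / H j\<bar> \<le> 2"
      using abs_avg_le[of "f j" I] 0[OF that] H[OF that] by (simp add: field_simps)
    thus ?thesis using abs_le_square_iff[of "avg (f j) I / H j" 2] by simp
  qed
  thus ?case using D by (auto intro!: mult_nonneg_nonneg sum_nonneg)
next
  case (Suc N I)
  show ?case
  proof (cases "g I")
    case True
    have A: "avg (\<lambda>x. \<bar>f j x\<bar>) (left_child I) \<le> 2 * H j \<and> avg (\<lambda>x. \<bar>f j x\<bar>) (right_child I) \<le> 2 * H j"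
      if "j < m" for j
      using avg_children[OF locint_abs[OF f[OF that]], of I] g[OF True that]
        avg_abs_nonneg[of "f j" "left_child I"] avg_abs_nonneg[of "f j" "right_child I"] by simp
    have "tree_energy w g (Suc N) I \<le> dlen I * (D * (\<Sum>j<m. (osc (f j) I / H j)\<^sup>2)) +
      dlen I / 2 * (D * (\<Sum>j<m. 4 - (avg (f j) (left_child I) / H j)\<^sup>2)) +
      dlen I / 2 * (D * (\<Sum>j<m. 4 - (avg (f j) (right_child I) / H j)\<^sup>2))"
    proof -
      have "tree_energy w g N (left_child I) \<le> dlen I / 2 * (D * (\<Sum>j<m. 4 - (avg (f j) (left_child I) / H j)\<^sup>2))"
        "tree_energy w g N (right_child I) \<le> dlen I / 2 * (D * (\<Sum>j<m. 4 - (avg (f j) (right_child I) / H j)\<^sup>2))"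
        using Suc.IH[of "left_child I"] Suc.IH[of "right_child I"] A by simp_all
      moreover have "dlen I * w I \<le> dlen I * (D * (\<Sum>j<m. (osc (f j) I / H j)\<^sup>2))"
        by (intro mult_left_mono w True) simp
      ultimately show ?thesis unfolding tree_energy.simps if_P[OF True] by linarith
    qed
    also have "\<dots> = dlen I * (D * (\<Sum>j<m. (osc (f j) I / H j)\<^sup>2 +
       (4 - (avg (f j) (left_child I) / H j)\<^sup>2) / 2 + (4 - (avg (f j) (right_child I) / H j)\<^sup>2) / 2))"
      by (simp add: sum.distrib sum_divide_distrib[symmetric] algebra_simps del: sum_subtractf)
    also have "(\<Sum>j<m. (osc (f j) I / H j)\<^sup>2 +
       (4 - (avg (f j) (left_child I) / H j)\<^sup>2) / 2 + (4 - (avg (f j) (right_child I) / H j)\<^sup>2) / 2) =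
       (\<Sum>j<m. 4 - (avg (f j) I / H j)\<^sup>2)"
    proof (rule sum.cong)
      fix j assume "j \<in> {..<m}"
      hence j: "j < m" by simp
      have "((b - a) / 2 / h)\<^sup>2 + (4 - (a / h)\<^sup>2) / 2 + (4 - (b / h)\<^sup>2) / 2 = 4 - ((a + b) / 2 / h)\<^sup>2"
        if "h > 0" for a b h :: real
        using that by (simp add: power2_eq_square field_simps)
      thus "(osc (f j) I / H j)\<^sup>2 + (4 - (avg (f j) (left_child I) / H j)\<^sup>2) / 2 +
          (4 - (avg (f j) (right_child I) / H j)\<^sup>2) / 2 = 4 - (avg (f j) I / H j)\<^sup>2"
        unfolding osc_def avg_children[OF f[OF j], of I] using H[OF j] by blast
    qed simp
    finally show ?thesis .
  next
    case False
    have "(avg (f j) I / H j)\<^sup>2 \<le> 4" if "j < m" for j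
    proof -
      have "\<bar>avg (f j) I / H j\<bar> \<le> 2"
        using abs_avg_le[of "f j" I] Suc.prems[OF that] H[OF that] by (simp add: field_simps)
      thus ?thesis using abs_le_square_iff[of "avg (f j) I / H j" 2] by simp
    qed
    thus ?thesis using D False by (auto intro!: mult_nonneg_nonneg sum_nonneg)
  qed
qed

text \<open>The starting condition of \<open>tree_energy_le\<close> disappears, since a good
  interval satisfies it and a bad one carries no energy. Discarding the subtracted squares leaves 4
  for each index.\<close>

lemma tree_energy_le_dlen:
  assumes f: "\<And>j. j < m \<Longrightarrow> locint (f j)" and H: "\<And>j. j < m \<Longrightarrow> 0 < H j"
    and g: "\<And>I j. g I \<Longrightarrow> j < m \<Longrightarrow> avg (\<lambda>x. \<bar>f j x\<bar>) I \<le> H j"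
    and w: "\<And>I. g I \<Longrightarrow> w I \<le> D * (\<Sum>j<m. (osc (f j) I / H j)\<^sup>2)"
    and D: "0 \<le> D"
  shows "tree_energy w g N I \<le> 4 * real m * D * dlen I"
proof (cases "g I")
  case True
  have "tree_energy w g N I \<le> dlen I * (D * (\<Sum>j<m. 4 - (avg (f j) I / H j)\<^sup>2))"
    using g[OF True] H by (intro tree_energy_le[OF f H g w D]) (auto, smt (verit))
  also have "\<dots> \<le> dlen I * (D * (\<Sum>j<m. 4))"
    using D by (intro mult_left_mono sum_mono) auto
  finally show ?thesis by (simp add: algebra_simps)
next
  case False
  thus ?thesis using D by (cases N) auto
qed

section \<open>Weak and strong type estimates\<close>

text \<open>This elementary splitting replaces the inequalities of Hoelder and Jensen throughout.\<close>

lemma abs_le_add_powr: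
  fixes a y p :: real
  assumes "0 < y" "1 \<le> p"
  shows "\<bar>a\<bar> \<le> y + y powr (1 - p) * \<bar>a\<bar> powr p"
proof (cases "\<bar>a\<bar> \<le> y")
  case False
  hence a: "0 < \<bar>a\<bar>" using assms by auto
  have "\<bar>a\<bar> = \<bar>a\<bar> powr (1 - p) * \<bar>a\<bar> powr p"
    using a by (simp flip: powr_add)
  also have "\<dots> \<le> y powr (1 - p) * \<bar>a\<bar> powr p"
    using False assms by (intro mult_right_mono powr_mono2') auto
  finally show ?thesis using assms by simp
qed (use assms in \<open>auto intro: add_increasing2\<close>)

lemma memLp_locint:
  assumes "memLp p f" "1 \<le> p"
  shows "locint f"
  unfolding locint_def set_integrable_def
proof
  fix I
  have "integrable lebesgue (\<lambda>x. indicator (dint I) x + \<bar>f x\<bar> powr p)"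
    using assms(1) by (intro Bochner_Integration.integrable_add)
      (auto simp: memLp_def emeasure_dint)
  thus "integrable lebesgue (\<lambda>x. indicat_real (dint I) x *\<^sub>R f x)"
  proof (rule Bochner_Integration.integrable_bound)
    show "AE x in lebesgue. norm (indicat_real (dint I) x *\<^sub>R f x) \<le>
        norm (indicator (dint I) x + \<bar>f x\<bar> powr p)"
    proof (rule AE_I2)
      fix x
      show "norm (indicat_real (dint I) x *\<^sub>R f x) \<le> norm (indicator (dint I) x + \<bar>f x\<bar> powr p)"
        using abs_le_add_powr[of 1 p "f x"] assms(2) by (auto simp: indicator_def)
    qed
  qed (use assms(1) in \<open>auto simp: memLp_def\<close>)
qed

lemma memLp_locint_powr:
  assumes "memLp p f"
  shows "locint (\<lambda>x. \<bar>f x\<bar> powr p)"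
  unfolding locint_def set_integrable_def
  using assms unfolding memLp_def by (intro allI integrable_mult_indicator) auto

lemma avg_mono:
  assumes "locint f" "locint h" "\<And>x. f x \<le> h x"
  shows "avg f I \<le> avg h I"
  unfolding avg_def using assms
  by (intro divide_right_mono set_integral_mono locintD) auto

lemma locint_const: "locint (\<lambda>_. y)"
  unfolding locint_def set_integrable_def by (simp add: emeasure_dint)

lemma avg_const: "avg (\<lambda>_. y) I = y"
  by (simp add: avg_def set_lebesgue_integral_def)

lemma locint_add: "locint f \<Longrightarrow> locint h \<Longrightarrow> locint (\<lambda>x. f x + h x)"
  unfolding locint_def by (blast intro: set_integral_add(1))

lemma avg_add: "locint f \<Longrightarrow> locint h \<Longrightarrow> avg (\<lambda>x. f x + h x) I = avg f I + avg h I"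
  unfolding avg_def by (simp add: set_integral_add locintD add_divide_distrib)

lemma locint_cmult: "locint f \<Longrightarrow> locint (\<lambda>x. a * f x)"
  unfolding locint_def by (auto intro: set_integrable_mult_right)

lemma avg_cmult: "avg (\<lambda>x. a * f x) I = a * avg f I"
  unfolding avg_def by simp

lemma avg_le_add_powr:
  assumes "memLp p f" "1 \<le> p" "0 < y"
  shows "avg (\<lambda>x. \<bar>f x\<bar>) I \<le> y + y powr (1 - p) * avg (\<lambda>x. \<bar>f x\<bar> powr p) I"
proof -
  note l = memLp_locint[OF assms(1,2)] memLp_locint_powr[OF assms(1)]
  have "avg (\<lambda>x. \<bar>f x\<bar>) I \<le> avg (\<lambda>x. y + y powr (1 - p) * \<bar>f x\<bar> powr p) I"
    by (intro avg_mono locint_add locint_cmult locint_const locint_abs l abs_le_add_powr assms)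
  also have "\<dots> = y + y powr (1 - p) * avg (\<lambda>x. \<bar>f x\<bar> powr p) I"
    using l by (simp add: avg_add avg_const avg_cmult locint_const locint_cmult)
  finally show ?thesis .
qed

lemma Lp_norm_powr:
  assumes "0 < p"
  shows "Lp_norm p f powr p = (\<integral>x. \<bar>f x\<bar> powr p \<partial>lebesgue)"
  unfolding Lp_norm_def using assms by (simp add: powr_powr)

lemma dlen_avg_le:
  assumes "integrable lebesgue f" "\<And>x. 0 \<le> f x"
  shows "dlen I * avg f I \<le> (\<integral>x. f x \<partial>lebesgue)"
proof -
  have "dlen I * avg f I = (\<integral>x. indicator (dint I) x * f x \<partial>lebesgue)"
    by (simp add: avg_def set_lebesgue_integral_def)
  also have "\<dots> \<le> (\<integral>x. f x \<partial>lebesgue)"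
    using assms integrable_mult_indicator[OF dint_sets(2) assms(1), of I]
    by (intro integral_mono) (auto simp: indicator_def)
  finally show ?thesis .
qed

lemma avg_le_Lp_norm:
  assumes "memLp p f" "1 \<le> p" "0 < Lp_norm p f"
  shows "avg (\<lambda>x. \<bar>f x\<bar>) I \<le> 2 * Lp_norm p f * dlen I powr (- 1 / p)"
proof -
  \<comment> \<open>This height balances the two terms of the splitting, each being at most
    \<open>y\<close>; hence the factor 2 where Hoelder's inequality would give 1.\<close>
  define y where "y = Lp_norm p f * dlen I powr (- 1 / p)"
  have y: "0 < y" using assms by (simp add: y_def)
  have "avg (\<lambda>x. \<bar>f x\<bar> powr p) I \<le> Lp_norm p f powr p / dlen I"
    using dlen_avg_le[of "\<lambda>x. \<bar>f x\<bar> powr p" I] assms Lp_norm_powr[of p f]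
    by (simp add: memLp_def field_simps)
  also have "\<dots> = y powr p"
    using assms unfolding y_def by (subst powr_mult) (auto simp: powr_powr simp flip: powr_minus_divide)
  finally have "y powr (1 - p) * avg (\<lambda>x. \<bar>f x\<bar> powr p) I \<le> y powr (1 - p) * y powr p"
    by (intro mult_left_mono) auto
  also have "\<dots> = y" using y by (simp flip: powr_add)
  finally show ?thesis
    using avg_le_add_powr[OF assms(1,2) y, of I] by (simp add: y_def)
qed

text \<open>Splitting at height \<open>H / 2\<close> turns an average of |f| above \<open>H\<close>
  into an average of |f|^p above \<open>(H / 2) powr p\<close>, and weak type (1,1) applies to
  |f|^p.\<close>

lemma measure_maximal_set_weak:
  assumes "memLp p f" "1 \<le> p" "0 < H"
  shows "measure lebesgue (maximal_set (avg (\<lambda>x. \<bar>f x\<bar>)) H N I) \<le> (2 / H) powr p * Lp_norm p f powr p"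
proof -
  note l = memLp_locint_powr[OF assms(1)]
  define H' where "H' = (H / 2) powr p"
  have H': "0 < H'" using assms by (simp add: H'_def)
  have *: "H' < avg (\<lambda>x. \<bar>f x\<bar> powr p) J" if "H < avg (\<lambda>x. \<bar>f x\<bar>) J" for J
  proof -
    have "H / 2 < (H / 2) powr (1 - p) * avg (\<lambda>x. \<bar>f x\<bar> powr p) J"
      using that avg_le_add_powr[OF assms(1,2), of "H/2" J] assms(3) by simp
    hence "(H / 2) powr (p - 1) * (H / 2) < (H / 2) powr (p - 1) *
        ((H / 2) powr (1 - p) * avg (\<lambda>x. \<bar>f x\<bar> powr p) J)"
      using assms(3) by (intro mult_strict_left_mono) auto
    moreover have "(H / 2) powr (p - 1) * (H / 2) = H'"
      using assms(3) powr_add[of "H/2" "p - 1" 1] by (simp add: H'_def)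
    moreover have "(H / 2) powr (p - 1) * ((H / 2) powr (1 - p) * z) = z" for z
      using assms(3) powr_add[of "H/2" "p - 1" "1 - p"] by (simp flip: mult.assoc)
    ultimately show ?thesis by simp
  qed
  have "maximal_set (avg (\<lambda>x. \<bar>f x\<bar>)) H N I \<subseteq> maximal_set (avg (\<lambda>x. \<bar>f x\<bar> powr p)) H' N I"
  proof
    fix x assume x: "x \<in> maximal_set (avg (\<lambda>x. \<bar>f x\<bar>)) H N I"
    hence "x \<in> dint I" using maximal_set_subset by blast
    with x show "x \<in> maximal_set (avg (\<lambda>x. \<bar>f x\<bar> powr p)) H' N I" by (auto simp: mem_maximal_set *)
  qed
  hence "H' * measure lebesgue (maximal_set (avg (\<lambda>x. \<bar>f x\<bar>)) H N I) \<le>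
      H' * measure lebesgue (maximal_set (avg (\<lambda>x. \<bar>f x\<bar> powr p)) H' N I)"
    using H' by (intro mult_left_mono measure_mono_fmeasurable fmeasurableD maximal_set_lmeasurable) auto
  also have "\<dots> \<le> dlen I * avg (\<lambda>x. \<bar>f x\<bar> powr p) I"
  proof (rule measure_maximal_set_le)
    show "0 \<le> avg (\<lambda>x. \<bar>f x\<bar> powr p) J" for J
      using avg_abs_nonneg[of "\<lambda>x. \<bar>f x\<bar> powr p" J] by simp
  qed (rule avg_children[OF l])
  also have "\<dots> \<le> Lp_norm p f powr p"
    using assms by (subst Lp_norm_powr) (auto simp: memLp_def intro!: dlen_avg_le)
  finally have "measure lebesgue (maximal_set (avg (\<lambda>x. \<bar>f x\<bar>)) H N I) \<le> Lp_norm p f powr p / H'"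
    using H' by (simp add: field_simps)
  also have "\<dots> = (2 / H) powr p * Lp_norm p f powr p"
    using assms(3) by (simp add: H'_def powr_divide)
  finally show ?thesis .
qed

text \<open>Values of |f| up to \<open>z\<close> add at most \<open>z\<close> to an average, so an
  average above \<open>2 * z\<close> forces the part of f above \<open>z\<close> to average more
  than \<open>z\<close>. Retaining only that part is what makes the bounds summable over
  levels.\<close>

lemma measure_maximal_set_truncated:
  assumes "locint f" "0 < z"
  shows "z * measure lebesgue (maximal_set (avg (\<lambda>x. \<bar>f x\<bar>)) (2 * z) N I) \<le>
    (LINT x:dint I|lebesgue. indicator {x. z < \<bar>f x\<bar>} x * \<bar>f x\<bar>)"
proof -
  define h where "h = (\<lambda>x. indicator {x. z < \<bar>f x\<bar>} x * \<bar>f x\<bar>)"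
  have fm: "set_borel_measurable lebesgue (dint J) f" for J
    using locintD[OF assms(1), of J] by (auto simp: set_integrable_def set_borel_measurable_def)
  have h: "locint h"
    unfolding locint_def
  proof
    fix J
    have "(\<lambda>x. indicator (dint J) x * h x) =
      (\<lambda>x. indicator {x. z < \<bar>indicator (dint J) x * f x\<bar>} x * \<bar>indicator (dint J) x * f x\<bar>)"
      by (auto simp: h_def fun_eq_iff indicator_def)
    moreover have [measurable]: "(\<lambda>x. indicator (dint J) x * f x) \<in> borel_measurable lebesgue"
      using fm[of J] by (simp add: set_borel_measurable_def)
    moreover have "{x. z < \<bar>indicator (dint J) x * f x\<bar>} \<in> sets lebesgue"
      using borel_measurable_less[of "\<lambda>_. z" lebesgue "\<lambda>x. \<bar>indicator (dint J) x * f x\<bar>"] by simp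
    ultimately have "set_borel_measurable lebesgue (dint J) h"
      by (simp add: set_borel_measurable_def)
    thus "set_integrable lebesgue (dint J) h"
      by (intro set_integrable_bound[OF locintD[OF assms(1)]])
         (auto simp: h_def indicator_def)
  qed
  have hn: "h x = \<bar>h x\<bar>" for x by (simp add: h_def)
  have *: "z < avg h J" if "2 * z < avg (\<lambda>x. \<bar>f x\<bar>) J" for J
  proof -
    have "avg (\<lambda>x. \<bar>f x\<bar>) J \<le> avg (\<lambda>x. z + h x) J"
      using assms by (intro avg_mono locint_abs locint_add locint_const h) (auto simp: h_def indicator_def)
    also have "\<dots> = z + avg h J"
      using h by (simp add: avg_add locint_const avg_const)
    finally show ?thesis using that by simp
  qed
  have "maximal_set (avg (\<lambda>x. \<bar>f x\<bar>)) (2 * z) N I \<subseteq> maximal_set (avg h) z N I"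
  proof
    fix x assume x: "x \<in> maximal_set (avg (\<lambda>x. \<bar>f x\<bar>)) (2 * z) N I"
    hence "x \<in> dint I" using maximal_set_subset by blast
    with x show "x \<in> maximal_set (avg h) z N I" by (auto simp: mem_maximal_set *)
  qed
  hence "z * measure lebesgue (maximal_set (avg (\<lambda>x. \<bar>f x\<bar>)) (2 * z) N I) \<le>
      z * measure lebesgue (maximal_set (avg h) z N I)"
    using assms by (intro mult_left_mono measure_mono_fmeasurable fmeasurableD maximal_set_lmeasurable) auto
  also have "\<dots> \<le> dlen I * avg h I"
    using avg_abs_nonneg[of h] hn by (intro measure_maximal_set_le avg_children h) simp
  finally show ?thesis by (simp add: avg_def h_def)
qed

section \<open>Geometric sums and the strong maximal estimate\<close>

lemma sum_powr_int_le:
  fixes q :: real and a b :: int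
  assumes "1 < q" "a \<le> b"
  shows "(\<Sum>k\<in>{a..b}. q powr real_of_int k) \<le> q powr (real_of_int b + 1) / (q - 1)"
  using assms(2)
proof (induction b rule: int_ge_induct)
  case base
  have "q powr real_of_int a * (q - 1) \<le> q powr real_of_int a * q"
    by (intro mult_left_mono) auto
  thus ?case using assms(1) by (simp add: powr_add pos_le_divide_eq)
next
  case (step b)
  have "{a..b + 1} = insert (b + 1) {a..b}" using step by auto
  hence "(\<Sum>k\<in>{a..b + 1}. q powr real_of_int k) = q powr (real_of_int b + 1) +
      (\<Sum>k\<in>{a..b}. q powr real_of_int k)"
    by simp
  also have "\<dots> \<le> q powr (real_of_int b + 1) + q powr (real_of_int b + 1) / (q - 1)"
    using step by simp
  also have "\<dots> = q powr (real_of_int b + 1) * q / (q - 1)"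
    using assms(1) by (simp add: field_simps)
  also have "\<dots> = q powr (real_of_int (b + 1) + 1) / (q - 1)"
    using assms(1) by (simp add: powr_add power2_eq_square)
  finally show ?case .
qed

text \<open>A geometric sum is comparable with its largest term, here less than \<open>w\<close>, so
  the range of summation leaves no trace in the bound.\<close>

lemma sum_powr_less_le:
  fixes q w :: real
  assumes "1 < q" "0 \<le> w"
  shows "(\<Sum>k\<in>{a..b::int}. if q powr real_of_int k < w then q powr real_of_int k else 0) \<le>
    q / (q - 1) * w"
proof -
  define K where "K = {k \<in> {a..b}. q powr real_of_int k < w}"
  have K: "finite K" unfolding K_def by (rule finite_subset[of _ "{a..b}"]) auto
  have eq: "(\<Sum>k\<in>{a..b}. if q powr real_of_int k < w then q powr real_of_int k else 0) =
      (\<Sum>k\<in>K. q powr real_of_int k)"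
    unfolding K_def by (rule sum.inter_filter[symmetric]) simp
  show ?thesis
  proof (cases "K = {}")
    case True
    thus ?thesis unfolding eq using assms by simp
  next
    case False
    define k0 where "k0 = Max K"
    have k0: "k0 \<in> K" using Max_in[OF K False] by (simp add: k0_def)
    have "K \<subseteq> {a..k0}" using Max_ge[OF K] by (auto simp: k0_def K_def)
    hence "(\<Sum>k\<in>K. q powr real_of_int k) \<le> (\<Sum>k\<in>{a..k0}. q powr real_of_int k)"
      by (intro sum_mono2) auto
    also have "\<dots> \<le> q powr (real_of_int k0 + 1) / (q - 1)"
      using k0 assms by (intro sum_powr_int_le) (auto simp: K_def)
    also have "\<dots> = q powr real_of_int k0 * q / (q - 1)"
      using assms by (simp add: powr_add)
    also have "\<dots> \<le> w * q / (q - 1)"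
      using k0 assms by (intro divide_right_mono mult_right_mono) (auto simp: K_def)
    finally show ?thesis unfolding eq by (simp add: mult.commute)
  qed
qed

text \<open>The strong maximal theorem in discrete layer-cake form, with levels in geometric
  progression. After sum and integral are exchanged, a point sees only the levels with
  \<open>z k < \<bar>f x\<bar>\<close>, and these form a geometric sum of ratio \<open>q\<close>.
  That \<open>q\<close> exceeds 1 is where \<open>p > 1\<close> enters.\<close>

lemma sum_measure_maximal_set_strong:
  assumes f: "memLp p f" and p: "1 < p" and \<rho>: "1 < \<rho>" and y: "0 < y"
  defines "q \<equiv> \<rho> powr (p - 1)"
  shows "(\<Sum>k\<in>{a..b}. \<rho> powr (real_of_int k * p) *
      measure lebesgue (maximal_set (avg (\<lambda>x. \<bar>f x\<bar>)) (y * \<rho> powr real_of_int k) N I)) \<le>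
    q / (q - 1) * (2 / y) powr p * Lp_norm p f powr p"
proof -
  have l: "locint f" using memLp_locint f p by simp
  have q: "1 < q" unfolding q_def using p \<rho> by (intro gr_one_powr) auto
  define z where "z k = y / 2 * \<rho> powr real_of_int k" for k
  have z: "0 < z k" for k using y \<rho> by (simp add: z_def)
  have ig: "integrable lebesgue (\<lambda>x. \<bar>f x\<bar> powr p)" using f by (simp add: memLp_def)
  have [measurable]: "f \<in> borel_measurable lebesgue" using f by (simp add: memLp_def)
  have fi: "integrable lebesgue (\<lambda>x. indicator (dint I) x * f x)"
    using locintD[OF l, of I] by (simp add: set_integrable_def)
  \<comment> \<open>The weight \<open>\<rho> powr (k * p)\<close> equals
    \<open>q powr k * (2 / y) * z k\<close>; its factor \<open>z k\<close> is used up by the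
    truncated estimate, and the rest appears here.\<close>
  define \<phi> where "\<phi> k x = q powr real_of_int k * (2 / y) * (indicator (dint I) x * (indicator {x. z k < \<bar>f x\<bar>} x * \<bar>f x\<bar>))" for k x
  have \<phi>i: "integrable lebesgue (\<phi> k)" for k
    unfolding \<phi>_def
  proof (rule integrable_mult_right)
    have [measurable]: "{x. z k < \<bar>f x\<bar>} \<in> sets lebesgue"
      using borel_measurable_less[of "\<lambda>_. z k" lebesgue "\<lambda>x. \<bar>f x\<bar>"] by simp
    show "integrable lebesgue (\<lambda>x. indicator (dint I) x * (indicator {x. z k < \<bar>f x\<bar>} x * \<bar>f x\<bar>))"
      by (rule Bochner_Integration.integrable_bound[OF fi]) (auto simp: indicator_def)
  qed
  have branch_term_le: "\<rho> powr (real_of_int k * p) *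
      measure lebesgue (maximal_set (avg (\<lambda>x. \<bar>f x\<bar>)) (y * \<rho> powr real_of_int k) N I) \<le> (\<integral>x. \<phi> k x \<partial>lebesgue)" for k
  proof -
    have "\<rho> powr (real_of_int k * p) = \<rho> powr (real_of_int k * (p - 1)) * \<rho> powr real_of_int k"
      by (simp add: algebra_simps flip: powr_add)
    also have "\<dots> = q powr real_of_int k * (2 / y) * z k"
      using y by (simp add: q_def z_def powr_powr mult.commute)
    finally have 1: "\<rho> powr (real_of_int k * p) = q powr real_of_int k * (2 / y) * z k" .
    have 2: "y * \<rho> powr real_of_int k = 2 * z k" by (simp add: z_def)
    have "q powr real_of_int k * (2 / y) * (z k * measure lebesgue (maximal_set (avg (\<lambda>x. \<bar>f x\<bar>)) (2 * z k) N I)) \<le>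
      q powr real_of_int k * (2 / y) * (LINT x:dint I|lebesgue. indicator {x. z k < \<bar>f x\<bar>} x * \<bar>f x\<bar>)"
      using y by (intro mult_left_mono measure_maximal_set_truncated l z) auto
    also have "\<dots> = (\<integral>x. \<phi> k x \<partial>lebesgue)"
      by (simp add: \<phi>_def set_lebesgue_integral_def)
    finally show ?thesis unfolding 1 2 by (simp add: mult.assoc)
  qed
  have pt: "(\<Sum>k\<in>{a..b}. \<phi> k x) \<le> q / (q - 1) * (2 / y) powr p * \<bar>f x\<bar> powr p" for x
  proof (cases "x \<in> dint I \<and> f x \<noteq> 0")
    case False
    thus ?thesis using q by (auto simp: \<phi>_def)
  next
    case True
    \<comment> \<open>Raising the condition \<open>z k < \<bar>f x\<bar>\<close> to the power
      \<open>p - 1\<close> turns it into a bound on the very terms \<open>q powr k\<close> that are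
      summed.\<close>
    define w where "w = (2 / y * \<bar>f x\<bar>) powr (p - 1)"
    have "z k < \<bar>f x\<bar> \<longleftrightarrow> q powr real_of_int k < w" for k
    proof -
      have "z k < \<bar>f x\<bar> \<longleftrightarrow> \<rho> powr real_of_int k < 2 / y * \<bar>f x\<bar>"
        using y by (simp add: z_def field_simps)
      also have "\<dots> \<longleftrightarrow> (\<rho> powr real_of_int k) powr (p - 1) < w"
        unfolding w_def using p y \<rho> True
        by (auto intro: powr_less_mono2 powr_less_cancel2[of "p - 1"])
      also have "(\<rho> powr real_of_int k) powr (p - 1) = q powr real_of_int k"
        by (simp add: q_def powr_powr mult.commute)
      finally show ?thesis .
    qed
    hence "(\<Sum>k\<in>{a..b}. \<phi> k x) = 2 / y * \<bar>f x\<bar> *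
       (\<Sum>k\<in>{a..b}. if q powr real_of_int k < w then q powr real_of_int k else 0)"
      unfolding sum_distrib_left using True by (intro sum.cong) (auto simp: \<phi>_def)
    also have "\<dots> \<le> 2 / y * \<bar>f x\<bar> * (q / (q - 1) * w)"
      using y q by (intro mult_left_mono sum_powr_less_le) (auto simp: w_def)
    also have "2 / y * \<bar>f x\<bar> * (q / (q - 1) * w) = q / (q - 1) * (w * (2 / y * \<bar>f x\<bar>) powr 1)"
      using y True by (simp add: ac_simps)
    also have "w * (2 / y * \<bar>f x\<bar>) powr 1 = (2 / y * \<bar>f x\<bar>) powr p"
      unfolding w_def by (subst powr_add[symmetric]) simp
    also have "\<dots> = (2 / y) powr p * \<bar>f x\<bar> powr p"
      using y by (intro powr_mult)
    finally show ?thesis by (simp add: mult.assoc)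
  qed
  have "(\<Sum>k\<in>{a..b}. \<rho> powr (real_of_int k * p) *
      measure lebesgue (maximal_set (avg (\<lambda>x. \<bar>f x\<bar>)) (y * \<rho> powr real_of_int k) N I)) \<le>
      (\<Sum>k\<in>{a..b}. \<integral>x. \<phi> k x \<partial>lebesgue)"
    by (intro sum_mono branch_term_le)
  also have "\<dots> = (\<integral>x. (\<Sum>k\<in>{a..b}. \<phi> k x) \<partial>lebesgue)"
    by (rule Bochner_Integration.integral_sum[symmetric]) (rule \<phi>i)
  also have "\<dots> \<le> (\<integral>x. q / (q - 1) * (2 / y) powr p * \<bar>f x\<bar> powr p \<partial>lebesgue)"
    by (intro integral_mono Bochner_Integration.integrable_sum \<phi>i integrable_mult_right ig pt)
  also have "\<dots> = q / (q - 1) * (2 / y) powr p * Lp_norm p f powr p"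
    using p by (simp add: Lp_norm_powr)
  finally show ?thesis .
qed

text \<open>The a priori bound \<open>A\<close> may be arbitrarily large: it does not enter the conclusion.\<close>

lemma iterate_weak:
  fixes a :: "real \<Rightarrow> real"
  assumes r: "0 < r" and a: "\<And>t. 0 < t \<Longrightarrow> a t \<le> A" and A: "0 \<le> A"
    and d: "d * 2 powr r \<le> 1 / 2" and a0: "\<And>t. 0 \<le> a t" 
    and it: "\<And>t. 0 < t \<Longrightarrow> a (2 * t) \<le> d * a t + b * t powr (- r)"
    and s: "0 < s"
  shows "a s \<le> 2 * 2 powr r * b * s powr (- r)"
proof -
  \<comment> \<open>The recursion X <= X/2 + 2^r b has the fixed point
    \<open>2 * 2 powr r * b\<close>, and each halving of the level halves the distance to it, so the
    weight of \<open>A\<close> is \<open>(1/2)^i\<close>.\<close>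
  have b: "s powr r * a s \<le> (1/2)^i * (s powr r * A) + 2 * 2 powr r * b * (1 - (1/2)^i)" if "0 < s" for i s
    using that
  proof (induction i arbitrary: s)
    case 0
    thus ?case using a[of s] by (simp add: mult_left_mono)
  next
    case (Suc i)
    define t where "t = s / 2"
    have t: "0 < t" "s = 2 * t" using Suc.prems by (auto simp: t_def)
    have sp: "s powr r = 2 powr r * t powr r" using t by (simp add: powr_mult)
    have "s powr r * a s \<le> s powr r * (d * a t + b * t powr (- r))"
      unfolding t(2) by (intro mult_left_mono it t) simp
    also have "\<dots> = (d * 2 powr r) * (t powr r * a t) + 2 powr r * b"
      unfolding sp using t(1) by (simp add: algebra_simps powr_minus)
    also have "(d * 2 powr r) * (t powr r * a t) \<le> 1/2 * (t powr r * a t)"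
      using d a0[of t] by (intro mult_right_mono) auto
    also have "t powr r * a t \<le> (1/2)^i * (t powr r * A) + 2 * 2 powr r * b * (1 - (1/2)^i)"
      by (rule Suc.IH[OF t(1)])
    also have "t powr r * A \<le> s powr r * A"
      using t A r by (intro mult_right_mono powr_mono2) auto
    finally show ?case by (simp add: algebra_simps)
  qed
  have "(\<lambda>i. (1/2)^i * (s powr r * A) + 2 * 2 powr r * b * (1 - (1/2)^i)) \<longlonglongrightarrow>
      0 * (s powr r * A) + 2 * 2 powr r * b * (1 - 0)"
    by (intro tendsto_intros LIMSEQ_realpow_zero) auto
  hence "s powr r * a s \<le> 2 * 2 powr r * b"
    using b[OF s] by (intro LIMSEQ_le_const[where X="\<lambda>i. (1/2)^i * (s powr r * A) + 2 * 2 powr r * b * (1 - (1/2)^i)"]) auto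
  thus ?thesis using s by (simp add: powr_minus field_simps)
qed

text \<open>Shifting the index by one makes the finite sum reappear on the right with factor 1/2,
  where it is absorbed. Only the boundary term at \<open>i - 1\<close> involves \<open>A\<close>; it
  vanishes when the lower end is moved to minus infinity, because the weights decay there.\<close>

lemma iterate_strong:
  fixes a b :: "int \<Rightarrow> real"
  assumes r: "0 < r" and a: "\<And>k. a k \<le> A" and a0: "\<And>k. 0 \<le> a k"
    and d: "d * 2 powr r \<le> 1 / 2" and b0: "\<And>k. 0 \<le> b k" 
    and it: "\<And>k. a (k + 1) \<le> d * a k + b k"
    and b: "\<And>i j. (\<Sum>k\<in>{i..j}. 2 powr (r * real_of_int k) * b k) \<le> B"
  shows "(\<Sum>k\<in>{i..j}. 2 powr (r * real_of_int k) * a k) \<le> 2 * 2 powr r * B"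
proof -
  let ?w = "\<lambda>k. 2 powr (r * real_of_int k)"
  have A: "0 \<le> A" using a[of 0] a0[of 0] by linarith
  have main: "(\<Sum>k\<in>{i..j}. ?w k * a k) \<le> A * 2 powr (r * real_of_int (i - 1)) + 2 * 2 powr r * B" for i
  proof -
    define X where "X = (\<Sum>k\<in>{i..j}. ?w k * a k)"
    have "X = (\<Sum>k\<in>{i - 1..j - 1}. ?w (k + 1) * a (k + 1))"
      unfolding X_def by (rule sum.reindex_bij_witness[of _ "\<lambda>k. k + 1" "\<lambda>k. k - 1"]) auto
    also have "\<dots> \<le> (\<Sum>k\<in>{i - 1..j - 1}. 1 / 2 * (?w k * a k) + 2 powr r * (?w k * b k))"
    proof (rule sum_mono)
      fix k
      have "?w (k + 1) * a (k + 1) \<le> ?w (k + 1) * (d * a k + b k)"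
        by (intro mult_left_mono it) simp
      also have "\<dots> = (d * 2 powr r) * (?w k * a k) + 2 powr r * (?w k * b k)"
        by (simp add: powr_add algebra_simps)
      also have "(d * 2 powr r) * (?w k * a k) \<le> 1 / 2 * (?w k * a k)"
        using d a0[of k] by (intro mult_right_mono) auto
      finally show "?w (k + 1) * a (k + 1) \<le> 1 / 2 * (?w k * a k) + 2 powr r * (?w k * b k)"
        by simp
    qed
    also have "\<dots> = 1 / 2 * (\<Sum>k\<in>{i - 1..j - 1}. ?w k * a k) + 2 powr r * (\<Sum>k\<in>{i - 1..j - 1}. ?w k * b k)"
      by (simp add: sum.distrib sum_distrib_left)
    also have "(\<Sum>k\<in>{i - 1..j - 1}. ?w k * a k) \<le> (\<Sum>k\<in>insert (i - 1) {i..j}. ?w k * a k)"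
      using a0 by (intro sum_mono2) auto
    also have "\<dots> = ?w (i - 1) * a (i - 1) + X"
      unfolding X_def by (subst sum.insert) auto
    also have "?w (i - 1) * a (i - 1) \<le> A * ?w (i - 1)"
      using a[of "i - 1"] by (simp add: mult.commute mult_right_mono)
    also have "2 powr r * (\<Sum>k\<in>{i - 1..j - 1}. ?w k * b k) \<le> 2 powr r * B"
      by (intro mult_left_mono b) simp
    finally have "X \<le> 1 / 2 * (A * ?w (i - 1) + X) + 2 powr r * B" by simp
    thus ?thesis unfolding X_def by (simp add: field_simps)
  qed
  have "(\<Sum>k\<in>{i..j}. ?w k * a k) \<le> A * 2 powr (r * (real_of_int i - 1 - real n)) + 2 * 2 powr r * B" for n
  proof -
    have "(\<Sum>k\<in>{i..j}. ?w k * a k) \<le> (\<Sum>k\<in>{i - int n..j}. ?w k * a k)"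
      using a0 by (intro sum_mono2) auto
    also have "\<dots> \<le> A * 2 powr (r * real_of_int (i - int n - 1)) + 2 * 2 powr r * B" by (rule main)
    finally show ?thesis by (simp add: algebra_simps)
  qed
  moreover have "(\<lambda>n. A * 2 powr (r * (real_of_int i - 1 - real n)) + 2 * 2 powr r * B) \<longlonglongrightarrow>
      A * 0 + 2 * 2 powr r * B"
  proof (intro tendsto_intros)
    have "(\<lambda>n. 2 powr (r * (real_of_int i - 1)) * (2 powr (- r)) ^ n) \<longlonglongrightarrow> 2 powr (r * (real_of_int i - 1)) * 0"
      using r by (intro tendsto_intros LIMSEQ_realpow_zero) (auto simp: powr_less_one)
    moreover have "2 powr (r * (real_of_int i - 1 - real n)) =
        2 powr (r * (real_of_int i - 1)) * (2 powr (- r)) ^ n" for n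
      by (simp add: powr_power algebra_simps flip: powr_add)
    ultimately show "(\<lambda>n. 2 powr (r * (real_of_int i - 1 - real n))) \<longlonglongrightarrow> 0" by simp
  qed
  ultimately show ?thesis
    by (intro LIMSEQ_le_const[where X="\<lambda>n. A * 2 powr (r * (real_of_int i - 1 - real n)) + 2 * 2 powr r * B"]) auto
qed

text \<open>If 2^k < |S x| <= 2^(k+1), the single level \<open>k\<close> already controls |S x|^r up
  to the factor 2^r. Since \<open>k\<close> may be any integer, the levels are exhausted
  symmetrically and monotone convergence is used.\<close>

lemma nn_integral_powr_le_sum:
  fixes S :: "real \<Rightarrow> real"
  assumes S: "S \<in> borel_measurable lebesgue" and J: "J \<in> lmeasurable" and r: "0 < r" and B: "0 \<le> B"
    and b: "\<And>i j. (\<Sum>k\<in>{i..j}. 2 powr (r * real_of_int k) *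
       measure lebesgue {x \<in> J. 2 powr real_of_int k < \<bar>S x\<bar>}) \<le> B"
  shows "(\<integral>\<^sup>+x. indicator J x * ennreal (\<bar>S x\<bar> powr r) \<partial>lebesgue) \<le> ennreal (2 powr r * B)"
proof -
  let ?w = "\<lambda>k. 2 powr (r * real_of_int k)"
  define E where "E k = {x \<in> J. 2 powr real_of_int k < \<bar>S x\<bar>}" for k
  have E: "E k \<in> lmeasurable" for k
  proof -
    have "{x. z < \<bar>S x\<bar>} \<in> sets lebesgue" for z
      using borel_measurable_less[of "\<lambda>_. z" lebesgue "\<lambda>x. \<bar>S x\<bar>"]
        borel_measurable_abs[OF S] by simp
    hence "J \<inter> {x. 2 powr real_of_int k < \<bar>S x\<bar>} \<in> lmeasurable"
      by (rule fmeasurable_Int_fmeasurable[OF J])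
    also have "J \<inter> {x. 2 powr real_of_int k < \<bar>S x\<bar>} = E k" by (auto simp: E_def)
    finally show ?thesis .
  qed
  define \<phi> where "\<phi> n x = (\<Sum>k\<in>{- int n..int n}. ennreal (?w k) * indicator (E k) x)" for n x
  have \<phi>m [measurable]: "\<phi> n \<in> borel_measurable lebesgue" for n
    unfolding \<phi>_def
    by (intro borel_measurable_sum borel_measurable_times_ennreal borel_measurable_const
        borel_measurable_indicator fmeasurableD E)
  have inc: "incseq \<phi>"
    unfolding incseq_def le_fun_def \<phi>_def by (intro allI impI sum_mono2) auto
  have pt: "indicator J x * ennreal (\<bar>S x\<bar> powr r) \<le> ennreal (2 powr r) * (SUP n. \<phi> n x)" for x
  proof (cases "x \<in> J \<and> S x \<noteq> 0")
    case True
    \<comment> \<open>The level sets are strict, so exact powers of 2 must fall to the level below: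
      ceiling minus one, not floor.\<close>
    define k where "k = \<lceil>log 2 \<bar>S x\<bar>\<rceil> - 1"
    have k: "real_of_int k < log 2 \<bar>S x\<bar>" "log 2 \<bar>S x\<bar> \<le> real_of_int k + 1"
      unfolding k_def by linarith+
    have k1: "2 powr real_of_int k < \<bar>S x\<bar>" using k(1) True by (simp add: less_log_iff)
    have "\<bar>S x\<bar> \<le> 2 powr (real_of_int k + 1)" using k(2) True by (simp add: log_le_iff)
    hence "\<bar>S x\<bar> powr r \<le> (2 powr (real_of_int k + 1)) powr r"
      using r by (intro powr_mono2) auto
    also have "\<dots> = 2 powr r * ?w k"
      by (simp add: powr_powr algebra_simps flip: powr_add)
    finally have "ennreal (\<bar>S x\<bar> powr r) \<le> ennreal (2 powr r) * ennreal (?w k)"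
      by (simp flip: ennreal_mult)
    also have "ennreal (?w k) = (\<Sum>k'\<in>{k}. ennreal (?w k') * indicator (E k') x)"
      using True k1 by (simp add: E_def)
    also have "\<dots> \<le> \<phi> (nat \<bar>k\<bar>) x"
      unfolding \<phi>_def by (intro sum_mono2) auto
    also have "\<dots> \<le> (SUP n. \<phi> n x)" by (rule SUP_upper) simp
    finally show ?thesis using True by (simp add: mult_left_mono)
  qed auto
  have "(\<integral>\<^sup>+x. indicator J x * ennreal (\<bar>S x\<bar> powr r) \<partial>lebesgue) \<le>
      (\<integral>\<^sup>+x. ennreal (2 powr r) * (SUP n. \<phi> n x) \<partial>lebesgue)"
    by (intro nn_integral_mono pt)
  also have "\<dots> = ennreal (2 powr r) * (SUP n. \<integral>\<^sup>+x. \<phi> n x \<partial>lebesgue)"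
    by (simp add: nn_integral_cmult nn_integral_monotone_convergence_SUP[OF inc])
  also have "\<dots> \<le> ennreal (2 powr r) * ennreal B"
  proof (intro mult_left_mono SUP_least)
    fix n
    have "(\<integral>\<^sup>+x. \<phi> n x \<partial>lebesgue) = (\<Sum>k\<in>{- int n..int n}. ennreal (?w k) * emeasure lebesgue (E k))"
      unfolding \<phi>_def using E[THEN fmeasurableD] by (subst nn_integral_sum) (auto simp: nn_integral_cmult_indicator)
    also have "\<dots> = (\<Sum>k\<in>{- int n..int n}. ennreal (?w k * measure lebesgue (E k)))"
      using E by (intro sum.cong) (auto simp: emeasure_eq_measure2 ennreal_mult)
    also have "\<dots> = ennreal (\<Sum>k\<in>{- int n..int n}. ?w k * measure lebesgue (E k))"
      by (rule sum_ennreal) simp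
    also have "\<dots> \<le> ennreal B" unfolding E_def by (intro ennreal_leI b)
    finally show "(\<integral>\<^sup>+x. \<phi> n x \<partial>lebesgue) \<le> ennreal B" .
  qed simp
  finally show ?thesis using B by (simp add: ennreal_mult)
qed

section \<open>The good-lambda inequality for Haar multipliers\<close>

text \<open>Coefficients without powers of the length; \<open>hcoef\<close> built from them is the
  \<open>c I\<close> of the overview.\<close>

definition dcoef :: "(real \<Rightarrow> real) \<Rightarrow> int \<times> int \<Rightarrow> nat \<Rightarrow> real" where
  "dcoef f I a = (if a = 0 then osc f I else avg f I)"

definition hcoef :: "(int \<times> int \<Rightarrow> real) \<Rightarrow> nat list \<Rightarrow> (nat \<Rightarrow> real \<Rightarrow> real) \<Rightarrow> int \<times> int \<Rightarrow> real" where
  "hcoef \<epsilon> \<alpha> f I = \<epsilon> I * (\<Prod>j<length \<alpha>. dcoef (f j) I (\<alpha> ! j))"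

text \<open>Every zero entry of \<open>\<alpha>\<close> contributes one factor |I|^(1/2). The
  resulting power is the inverse of the one carried by \<open>haar I x ^ sigma \<alpha>\<close>, so
  lengths cancel from the multiplier.\<close>

lemma prod_coef_eq:
  assumes "\<And>j. j < length \<alpha> \<Longrightarrow> locint (f j)"
  shows "(\<Prod>j<length \<alpha>. coef (f j) I (\<alpha> ! j)) =
    dlen I powr (real (sigma \<alpha>) / 2) * (\<Prod>j<length \<alpha>. dcoef (f j) I (\<alpha> ! j))"
proof -
  have "(\<Prod>j<length \<alpha>. coef (f j) I (\<alpha> ! j)) =
    (\<Prod>j<length \<alpha>. (if \<alpha> ! j = 0 then dlen I powr (1/2) else 1) * dcoef (f j) I (\<alpha> ! j))"
  proof (rule prod.cong)
    fix j assume "j \<in> {..<length \<alpha>}"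
    hence "locint (f j)" using assms by simp
    thus "coef (f j) I (\<alpha> ! j) =
        (if \<alpha> ! j = 0 then dlen I powr (1/2) else 1) * dcoef (f j) I (\<alpha> ! j)"
      by (auto simp: dcoef_def coef_0) (simp add: coef_def avg_def)
  qed simp
  also have "\<dots> = (\<Prod>j<length \<alpha>. if \<alpha> ! j = 0 then dlen I powr (1/2) else 1) *
      (\<Prod>j<length \<alpha>. dcoef (f j) I (\<alpha> ! j))"
    by (rule prod.distrib)
  also have "(\<Prod>j<length \<alpha>. if \<alpha> ! j = 0 then dlen I powr (1/2) else 1) =
      (\<Prod>j\<in>{j \<in> {..<length \<alpha>}. \<alpha> ! j = 0}. dlen I powr (1/2))"
    by (rule prod.inter_filter[symmetric]) simp
  also have "\<dots> = (dlen I powr (1/2)) ^ sigma \<alpha>"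
    by (simp add: sigma_def length_filter_conv_card)
  also have "\<dots> = dlen I powr (real (sigma \<alpha>) / 2)"
    by (subst powr_power) auto
  finally show ?thesis .
qed

lemma haar_term_eq:
  assumes "\<And>j. j < length \<alpha> \<Longrightarrow> locint (f j)" "x \<in> dint I"
  shows "haar_term \<epsilon> \<alpha> f I x = branch_term (hcoef \<epsilon> \<alpha> f) ((-1) ^ sigma \<alpha>) I x"
proof -
  have "dlen I powr (real (sigma \<alpha>) / 2) * dlen I powr (- real (sigma \<alpha>) / 2) = 1"
    by (simp flip: powr_add)
  moreover have "(\<Prod>j<length \<alpha>. coef (f j) I (\<alpha> ! j)) =
      dlen I powr (real (sigma \<alpha>) / 2) * (\<Prod>j<length \<alpha>. dcoef (f j) I (\<alpha> ! j))"
    using assms(1) by (rule prod_coef_eq)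
  ultimately show ?thesis
    unfolding haar_term_def haar_power[OF assms(2)] branch_term_def hcoef_def
    by (simp add: algebra_simps)
qed

text \<open>The condition on \<open>sigma\<close> matters because off the interval the last factor
  is \<open>0 ^ sigma \<alpha>\<close>, which would be 1 for exponent 0.\<close>

lemma infsum_haar_term:
  assumes "\<And>j. j < length \<alpha> \<Longrightarrow> locint (f j)" "sigma \<alpha> \<noteq> 0"
  shows "(\<Sum>\<^sub>\<infinity>k::int. haar_term \<epsilon> \<alpha> f (n, k) x) =
    branch_term (hcoef \<epsilon> \<alpha> f) ((-1) ^ sigma \<alpha>) (dyad n x) x"
proof (rule infsumI, rule has_sum_finite_neutralI[where B="{snd (dyad n x)}"])
  fix k assume "k \<in> UNIV - {snd (dyad n x)}"
  hence "dyad n x \<noteq> (n, k)" by auto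
  hence "x \<notin> dint (n, k)" by (simp add: mem_dint_iff)
  thus "haar_term \<epsilon> \<alpha> f (n, k) x = 0"
    using assms(2) by (simp add: haar_term_def haar_outside)
next
  have "(n, snd (dyad n x)) = dyad n x" by (simp add: dyad_def)
  thus "branch_term (hcoef \<epsilon> \<alpha> f) ((-1) ^ sigma \<alpha>) (dyad n x) x =
      (\<Sum>k\<in>{snd (dyad n x)}. haar_term \<epsilon> \<alpha> f (n, k) x)"
    using haar_term_eq[OF assms(1), where x=x and I="dyad n x"] by simp
qed auto

lemma haar_mult_eq:
  assumes "\<And>j. j < length \<alpha> \<Longrightarrow> locint (f j)" "sigma \<alpha> \<noteq> 0"
  shows "haar_mult \<epsilon> \<alpha> f x =
    lim (\<lambda>N. path_sum (hcoef \<epsilon> \<alpha> f) ((-1) ^ sigma \<alpha>) (2 * N + 1) (- int N) x)"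
proof -
  have "(\<Sum>n\<in>{- int N..int N}. branch_term c e (dyad n x) x) = path_sum c e (2 * N + 1) (- int N) x" for N c e
    unfolding path_sum_def
    by (rule sum.reindex_bij_witness[of _ "\<lambda>l. - int N + int l" "\<lambda>n. nat (n + int N)"]) auto
  thus ?thesis
    unfolding haar_mult_def using assms by (simp add: infsum_haar_term)
qed

lemma path_sum_measurable: "path_sum c e i n \<in> borel_measurable lebesgue"
proof -
  have fl: "(\<lambda>x. \<lfloor>x * 2 powr real_of_int n\<rfloor>) \<in> measurable lebesgue (count_space UNIV)" for n
    by (rule measurable_compose[OF _ measurable_real_floor])
      (auto intro!: measurable_completion)
  \<comment> \<open>The term depends on \<open>x\<close> only through its integer positions in
    generations \<open>n\<close> and \<open>n + 1\<close>, so it is a function on a countable space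
    composed with two floors.\<close>
  have "branch_term c e (dyad n x) x = (case (\<lfloor>x * 2 powr real_of_int n\<rfloor>, \<lfloor>x * 2 powr real_of_int (n + 1)\<rfloor>) of
     (k, k') \<Rightarrow> c (n, k) * (if k' = 2 * k + 1 then 1 else e))" for n x
    by (auto simp: branch_term_def mem_dint_iff right_child_def dyad_def)
  moreover have "(\<lambda>x. case (\<lfloor>x * 2 powr real_of_int n\<rfloor>, \<lfloor>x * 2 powr real_of_int (n + 1)\<rfloor>) of
     (k, k') \<Rightarrow> c (n, k) * (if k' = 2 * k + 1 then 1 else e)) \<in> borel_measurable lebesgue" for n
    by (rule measurable_compose[OF measurable_Pair[OF fl fl, of n "n + 1"]])
       (simp add: pair_measure_countable)
  ultimately have "(\<lambda>x. branch_term c e (dyad n x) x) \<in> borel_measurable lebesgue" for n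
    by (simp only:)
  thus ?thesis
    unfolding path_sum_def by (intro borel_measurable_sum)
qed

lemma prod_le_prod_subset:
  fixes h :: "'b \<Rightarrow> real"
  assumes "finite A" "S \<subseteq> A" "\<And>j. j \<in> A \<Longrightarrow> 0 \<le> h j \<and> h j \<le> 1"
  shows "prod h A \<le> prod h S"
proof -
  have "prod h A = prod h (A - S) * prod h S"
    using assms by (intro prod.subset_diff) auto
  also have "\<dots> \<le> 1 * prod h S"
    using assms by (intro mult_right_mono prod_le_1 prod_nonneg) auto
  finally show ?thesis by simp
qed

section \<open>Bounds for a fixed tuple of locally integrable functions\<close>

locale haar_setup =
  fixes m :: nat and \<epsilon> :: "int \<times> int \<Rightarrow> real" and \<alpha> :: "nat list" and f :: "nat \<Rightarrow> real \<Rightarrow> real"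
    and B :: real
  assumes len: "length \<alpha> = m" and sig: "sigma \<alpha> \<noteq> 0" and B: "0 < B" and \<epsilon>: "\<And>I. \<bar>\<epsilon> I\<bar> \<le> B"
    and f: "\<And>j. j < m \<Longrightarrow> locint (f j)"
begin

abbreviation "c \<equiv> hcoef \<epsilon> \<alpha> f"
abbreviation "e \<equiv> (-1::real) ^ sigma \<alpha>"
abbreviation "A j \<equiv> avg (\<lambda>x. \<bar>f j x\<bar>)"

definition q :: nat where "q = (if even (sigma \<alpha>) then 1 else 2)"

definition good :: "(nat \<Rightarrow> real) \<Rightarrow> int \<times> int \<Rightarrow> bool" where
  "good H I \<longleftrightarrow> (\<forall>j<m. A j I \<le> H j)"

lemma q_pos: "q \<noteq> 0" "1 \<le> q"
  by (simp_all add: q_def)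

lemma m_pos: "0 < m"
  using sig len by (cases \<alpha>) (auto simp: sigma_def)

text \<open>Even \<open>sigma\<close>: \<open>e = 1\<close> and \<open>q = 1\<close>, the triangle
  inequality. Odd \<open>sigma\<close>: \<open>e = -1\<close> and \<open>q = 2\<close>, the
  parallelogram law with equality.\<close>

lemma parallelogram: "\<bar>u + e * v\<bar> ^ q + \<bar>u + v\<bar> ^ q \<le> 2 * (\<bar>u\<bar> ^ q + \<bar>v\<bar> ^ q)"
proof (cases "even (sigma \<alpha>)")
  case True
  thus ?thesis using abs_triangle_ineq[of u v] by (simp add: q_def)
qed (auto simp: q_def power2_eq_square algebra_simps)

lemma abs_dcoef_le: "j < m \<Longrightarrow> \<bar>dcoef (f j) I a\<bar> \<le> A j I"
  using abs_osc_le[OF f] abs_avg_le by (simp add: dcoef_def)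

lemma abs_c_le:
  assumes "\<And>j. j < m \<Longrightarrow> A j I \<le> H j"
  shows "\<bar>c I\<bar> \<le> B * (\<Prod>j<m. H j)"
proof -
  have "\<bar>c I\<bar> = \<bar>\<epsilon> I\<bar> * (\<Prod>j<m. \<bar>dcoef (f j) I (\<alpha> ! j)\<bar>)"
    by (simp add: hcoef_def abs_mult abs_prod len)
  also have "\<dots> \<le> B * (\<Prod>j<m. H j)"
    using B \<epsilon> order_trans[OF abs_dcoef_le assms]
    by (intro mult_mono prod_mono conjI prod_nonneg) auto
  finally show ?thesis .
qed

text \<open>If the number of Haar coefficients is even it is at least two, and AM-GM applies to two oscillation
  factors; if it is odd, one oscillation factor is squared.\<close>

lemma abs_c_power_le:
  assumes H: "\<And>j. j < m \<Longrightarrow> 0 < H j" and g: "good H I"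
  shows "\<bar>c I\<bar> ^ q \<le> (B * (\<Prod>j<m. H j)) ^ q * (\<Sum>j<m. (osc (f j) I / H j)\<^sup>2)"
proof -
  \<comment> \<open>On a good interval these normalised factors lie between 0 and 1, so all but the
    useful oscillation factors can be discarded.\<close>
  define \<rho> where "\<rho> j = \<bar>dcoef (f j) I (\<alpha> ! j)\<bar> / H j" for j
  define Z where "Z = {j. j < m \<and> \<alpha> ! j = 0}"
  define R where "R = (\<Sum>j<m. (osc (f j) I / H j)\<^sup>2)"
  have finZ: "finite Z" "card Z = sigma \<alpha>"
    by (simp_all add: Z_def sigma_def length_filter_conv_card len)
  have \<rho>: "0 \<le> \<rho> j \<and> \<rho> j \<le> 1" if "j \<in> {..<m}" for j
    using abs_dcoef_le[of j I "\<alpha> ! j"] g H[of j] that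
    by (auto simp: \<rho>_def good_def field_simps intro: order_trans)
  have "\<bar>c I\<bar> = \<bar>\<epsilon> I\<bar> * ((\<Prod>j<m. H j) * (\<Prod>j<m. \<rho> j))"
  proof -
    have "(\<Prod>j<m. H j) * (\<Prod>j<m. \<rho> j) = (\<Prod>j<m. \<bar>dcoef (f j) I (\<alpha> ! j)\<bar>)"
      unfolding prod.distrib[symmetric] using H
      by (intro prod.cong) (force simp: \<rho>_def)+
    thus ?thesis by (simp add: hcoef_def abs_mult abs_prod len)
  qed
  also have "\<dots> \<le> B * ((\<Prod>j<m. H j) * (\<Prod>j<m. \<rho> j))"
    using \<epsilon> H \<rho> by (intro mult_right_mono mult_nonneg_nonneg prod_nonneg) (auto intro: less_imp_le)
  finally have "\<bar>c I\<bar> ^ q \<le> (B * (\<Prod>j<m. H j) * (\<Prod>j<m. \<rho> j)) ^ q"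
    by (intro power_mono) (auto simp: mult.assoc)
  also have "\<dots> = (B * (\<Prod>j<m. H j)) ^ q * (\<Prod>j<m. \<rho> j) ^ q"
    by (simp add: power_mult_distrib)
  also have "\<dots> \<le> (B * (\<Prod>j<m. H j)) ^ q * R"
  proof (rule mult_left_mono)
    show "0 \<le> (B * (\<Prod>j<m. H j)) ^ q"
      using B H by (intro zero_le_power mult_nonneg_nonneg prod_nonneg) (auto intro: less_imp_le)
    have sq: "(\<rho> j)\<^sup>2 = (osc (f j) I / H j)\<^sup>2" if "j \<in> Z" for j
      using that by (simp add: \<rho>_def Z_def dcoef_def power_divide)
    have P0: "0 \<le> (\<Prod>j<m. \<rho> j)" using \<rho> by (intro prod_nonneg) auto
    show "(\<Prod>j<m. \<rho> j) ^ q \<le> R"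
    proof (cases "even (sigma \<alpha>)")
      case True
      hence "2 \<le> card Z" using sig finZ by (cases "sigma \<alpha> = 1") auto
      then obtain S where S: "S \<subseteq> Z" "card S = 2" by (metis obtain_subset_with_card_n)
      then obtain j k where jk: "S = {j, k}" "j \<noteq> k" by (metis card_2_iff)
      have mem: "j \<in> Z" "k \<in> Z" "j < m" "k < m" using S jk by (auto simp: Z_def)
      have "(\<Prod>j<m. \<rho> j) \<le> prod \<rho> {j, k}"
        using mem \<rho> by (intro prod_le_prod_subset) auto
      also have "\<dots> = \<rho> j * \<rho> k" using jk by simp
      also have "\<dots> \<le> (\<rho> j)\<^sup>2 + (\<rho> k)\<^sup>2"
      proof -
        have "0 \<le> \<rho> j * \<rho> k" using \<rho> mem by (intro mult_nonneg_nonneg) auto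
        thus ?thesis using sum_squares_bound[of "\<rho> j" "\<rho> k"] by linarith
      qed
      also have "\<dots> = (\<Sum>j\<in>{j, k}. (osc (f j) I / H j)\<^sup>2)" using jk sq mem by simp
      also have "\<dots> \<le> R" unfolding R_def using mem by (intro sum_mono2) auto
      finally show ?thesis using True by (simp add: q_def)
    next
      case False
      hence "Z \<noteq> {}" using sig finZ by auto
      then obtain j where j: "j \<in> Z" by blast
      hence jm: "j < m" by (simp add: Z_def)
      have "(\<Prod>j<m. \<rho> j) \<le> prod \<rho> {j}"
        using jm \<rho> by (intro prod_le_prod_subset) auto
      hence "(\<Prod>j<m. \<rho> j)\<^sup>2 \<le> (\<rho> j)\<^sup>2" using P0 by (intro power_mono) auto
      also have "\<dots> = (\<Sum>j\<in>{j}. (osc (f j) I / H j)\<^sup>2)" using sq j by simp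
      also have "\<dots> \<le> R" unfolding R_def using jm by (intro sum_mono2) auto
      finally show ?thesis using False by (simp add: q_def)
    qed
  qed
  finally show ?thesis by (simp add: R_def)
qed

lemma tree_energy_bound:
  assumes H: "\<And>j. j < m \<Longrightarrow> 0 < H j"
  shows "tree_energy (\<lambda>I. \<bar>c I\<bar> ^ q) (good H) N I \<le> 4 * real m * (B * (\<Prod>j<m. H j)) ^ q * dlen I"
proof (rule tree_energy_le_dlen[OF f H])
  show "0 \<le> (B * (\<Prod>j<m. H j)) ^ q"
    using B H by (intro zero_le_power mult_nonneg_nonneg prod_nonneg) (auto intro: less_imp_le)
qed (use H abs_c_power_le in \<open>auto simp: good_def\<close>)

lemma measure_exceed_set_good_le:
  assumes H: "\<And>j. j < m \<Longrightarrow> 0 < H j" and s: "0 < s" "B * (\<Prod>j<m. H j) \<le> s"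
  shows "measure lebesgue (exceed_set c e (good H) s N I 0) \<le>
    4 * real m * (B * (\<Prod>j<m. H j) / s) * dlen I"
proof -
  define D where "D = B * (\<Prod>j<m. H j)"
  have D: "0 < D" unfolding D_def using B H by (intro mult_pos_pos prod_pos) auto
  have "s ^ q * measure lebesgue (exceed_set c e (good H) s N I 0) \<le> 4 * real m * D ^ q * dlen I"
    using measure_exceed_set_le_tree_energy[OF parallelogram, of s c "good H" N I 0] tree_energy_bound[of H N I, OF H] s(1) q_pos
    by (simp add: power_0_left D_def)
  hence "measure lebesgue (exceed_set c e (good H) s N I 0) \<le> 4 * real m * (D / s) ^ q * dlen I"
    using s(1) by (simp add: power_divide field_simps)
  \<comment> \<open>Since \<open>D \<le> s\<close>, lowering the exponent to 1 only enlarges the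
    bound; both parities thus get the same linear estimate.\<close>
  also have "(D / s) ^ q \<le> (D / s) ^ 1"
    using D s q_pos by (intro power_decreasing) (auto simp: D_def)
  hence "4 * real m * (D / s) ^ q * dlen I \<le> 4 * real m * (D / s) * dlen I"
    by (intro mult_right_mono mult_left_mono) auto
  finally show ?thesis by (simp add: D_def)
qed

text \<open>A path whose sum exceeds \<open>2 * t\<close> either stays good until then or meets an
  interval with too large an average. The factor \<open>8 * m * B * \<gamma>\<close> is
  \<open>4 * m\<close> times \<open>B * \<gamma> * t\<close> over the level \<open>t / 2\<close>,
  and \<open>2 * B * \<gamma> \<le> 1\<close> keeps single coefficients on good intervals below
  \<open>t / 2\<close>.\<close>

lemma good_lambda_step:
  assumes H: "\<And>j. j < m \<Longrightarrow> 0 < H j" and t: "0 < t" and P: "(\<Prod>j<m. H j) = \<gamma> * t"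
    and \<gamma>: "2 * B * \<gamma> \<le> 1"
  shows "measure lebesgue (exceed_set c e (\<lambda>_. True) (2 * t) N I 0) \<le>
    8 * real m * B * \<gamma> * measure lebesgue (exceed_set c e (\<lambda>_. True) t N I 0) +
    (\<Sum>j<m. measure lebesgue (maximal_set (A j) (H j) N I))"
proof -
  have \<gamma>0: "0 < \<gamma>"
  proof -
    have "0 < \<gamma> * t" unfolding P[symmetric] using H by (intro prod_pos) auto
    thus ?thesis using t by (simp add: zero_less_mult_iff)
  qed
  have Bt: "B * (\<gamma> * t) \<le> t / 2"
    using \<gamma> t mult_right_mono[of "2 * B * \<gamma>" 1 t] by (simp add: algebra_simps)
  have sub: "exceed_set c e (\<lambda>_. True) (2 * t) N I 0 \<subseteq>
      exceed_set c e (good H) (2 * t) N I 0 \<union> (\<Union>j\<in>{..<m}. maximal_set (A j) (H j) N I)"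
  proof
    fix x assume x: "x \<in> exceed_set c e (\<lambda>_. True) (2 * t) N I 0"
    hence xI: "x \<in> dint I" using exceed_set_subset by blast
    from x obtain i where i: "i \<le> N" "2 * t < \<bar>0 + path_sum c e i (fst I) x\<bar>"
      unfolding mem_exceed_set[OF xI] by blast
    show "x \<in> exceed_set c e (good H) (2 * t) N I 0 \<union> (\<Union>j\<in>{..<m}. maximal_set (A j) (H j) N I)"
    proof (cases "\<forall>l<i. good H (dyad (fst I + int l) x)")
      case True
      thus ?thesis using i unfolding Un_iff mem_exceed_set[OF xI] by blast
    next
      case False
      then obtain l j where "l < i" "j < m" "H j < A j (dyad (fst I + int l) x)"
        by (auto simp: good_def not_le)
      hence "x \<in> maximal_set (A j) (H j) N I" using i unfolding mem_maximal_set[OF xI] by (intro exI[of _ l]) auto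
      thus ?thesis using \<open>j < m\<close> by blast
    qed
  qed
  have "measure lebesgue (exceed_set c e (\<lambda>_. True) (2 * t) N I 0) \<le>
    measure lebesgue (exceed_set c e (good H) (2 * t) N I 0 \<union> (\<Union>j\<in>{..<m}. maximal_set (A j) (H j) N I))"
    by (intro measure_mono_fmeasurable sub fmeasurableD exceed_set_lmeasurable fmeasurable.Un
        fmeasurable.finite_UN maximal_set_lmeasurable) auto
  also have "\<dots> \<le> measure lebesgue (exceed_set c e (good H) (2 * t) N I 0) +
      measure lebesgue (\<Union>j\<in>{..<m}. maximal_set (A j) (H j) N I)"
    by (intro measure_Un_le sets.finite_UN fmeasurableD exceed_set_lmeasurable maximal_set_lmeasurable) auto
  also have "measure lebesgue (\<Union>j\<in>{..<m}. maximal_set (A j) (H j) N I) \<le>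
      (\<Sum>j<m. measure lebesgue (maximal_set (A j) (H j) N I))"
    by (intro measure_UNION_le fmeasurableD maximal_set_lmeasurable) auto
  also have "measure lebesgue (exceed_set c e (good H) (2 * t) N I 0) \<le>
      8 * real m * B * \<gamma> * measure lebesgue (exceed_set c e (\<lambda>_. True) t N I 0)"
  proof (rule good_lambda)
    fix N I
    show "measure lebesgue (exceed_set c e (good H) (t / 2) N I 0) \<le> 8 * real m * B * \<gamma> * dlen I"
      using measure_exceed_set_good_le[of H "t/2" N I, OF H] t Bt P by (simp add: mult.assoc)
  next
    fix I assume "good H I"
    thus "\<bar>c I\<bar> \<le> t / 2"
      using abs_c_le[of I H] Bt P by (auto simp: good_def)
  qed (use t B \<gamma>0 in \<open>auto simp: power_abs\<close>)
  finally show ?thesis by simp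
qed

end

text \<open>Solves \<open>8 * m * B * \<gamma> * 2 powr r = 1 / 2\<close>: doubling the level costs
  a factor 2^r, and the iterations need a net factor of at most 1/2.\<close>

definition good_lambda_const :: "nat \<Rightarrow> real \<Rightarrow> real \<Rightarrow> real" where
  "good_lambda_const m B r = 1 / (16 * real m * B * 2 powr r)"

text \<open>Positive norms keep \<open>P\<close> and all thresholds positive. A tuple with a
  vanishing norm is treated apart, since then all coefficients of one function are zero and so is
  the multiplier.\<close>

locale haar_setup_Lp = haar_setup +
  fixes p :: "nat \<Rightarrow> real" and r :: real
  assumes p: "\<And>j. j < m \<Longrightarrow> 1 \<le> p j" and pr: "(\<Sum>j<m. 1 / p j) = 1 / r"
    and fL: "\<And>j. j < m \<Longrightarrow> memLp (p j) (f j)" and fN: "\<And>j. j < m \<Longrightarrow> 0 < Lp_norm (p j) (f j)"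
begin

definition P :: real where "P = (\<Prod>j<m. Lp_norm (p j) (f j))"
abbreviation "\<gamma> \<equiv> good_lambda_const m B r"
text \<open>The thresholds are balanced: their product is \<open>\<gamma> * t\<close>, while each maximal function exceeds its
  threshold on a set of measure of order \<open>t powr (- r)\<close>.\<close>

definition H :: "real \<Rightarrow> nat \<Rightarrow> real" where "H t j = Lp_norm (p j) (f j) * (\<gamma> * t / P) powr (r / p j)"

lemma P_pos: "0 < P"
  unfolding P_def using fN by (intro prod_pos) auto

lemma r_pos: "0 < r"
proof -
  have "0 < (\<Sum>j<m. 1 / p j)"
    using m_pos p by (intro sum_pos) (force intro!: divide_pos_pos)+
  thus ?thesis unfolding pr by simp
qed

lemma \<gamma>_pos: "0 < \<gamma>"
  using m_pos B by (simp add: good_lambda_const_def)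

lemma H_pos: "0 < t \<Longrightarrow> j < m \<Longrightarrow> 0 < H t j"
  using fN P_pos \<gamma>_pos by (simp add: H_def)

text \<open>The Hoelder relation for the exponents enters here: the powers \<open>r / p j\<close>
  add up to 1.\<close>

lemma prod_H:
  assumes "0 < t"
  shows "(\<Prod>j<m. H t j) = \<gamma> * t"
proof -
  have y: "0 < \<gamma> * t / P" using assms P_pos \<gamma>_pos by simp
  have "(\<Prod>j<m. H t j) = P * (\<Prod>j<m. (\<gamma> * t / P) powr (r / p j))"
    unfolding H_def P_def by (rule prod.distrib)
  also have "(\<Prod>j<m. (\<gamma> * t / P) powr (r / p j)) = (\<gamma> * t / P) powr (\<Sum>j<m. r / p j)"
    using y by (intro powr_sum[symmetric]) auto
  also have "(\<Sum>j<m. r / p j) = r * (\<Sum>j<m. 1 / p j)"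
    by (simp add: sum_distrib_left)
  also have "\<dots> = 1" unfolding pr using r_pos by simp
  finally show ?thesis using assms \<gamma>_pos P_pos by simp
qed

lemma two_B_\<gamma>: "2 * B * \<gamma> \<le> 1" and \<gamma>_small: "8 * real m * B * \<gamma> * 2 powr r \<le> 1 / 2"
proof -
  have "1 \<le> 2 powr r" using r_pos by (simp add: ge_one_powr_ge_zero)
  moreover have "1 \<le> real m" using m_pos by simp
  ultimately have "1 \<le> real m * 2 powr r" using mult_mono[of 1 "real m" 1 "2 powr r"] by simp
  moreover have "2 * B * \<gamma> = 1 / (8 * (real m * 2 powr r))" using B by (simp add: good_lambda_const_def)
  ultimately show "2 * B * \<gamma> \<le> 1" by (simp add: field_simps)
  show "8 * real m * B * \<gamma> * 2 powr r \<le> 1 / 2"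
    using B m_pos by (simp add: good_lambda_const_def)
qed

lemma good_lambda_H:
  assumes "0 < t"
  shows "measure lebesgue (exceed_set c e (\<lambda>_. True) (2 * t) N I 0) \<le>
    8 * real m * B * \<gamma> * measure lebesgue (exceed_set c e (\<lambda>_. True) t N I 0) +
    (\<Sum>j<m. measure lebesgue (maximal_set (A j) (H t j) N I))"
  using assms by (intro good_lambda_step H_pos prod_H two_B_\<gamma>)

text \<open>At the threshold \<open>H t j\<close> the weak maximal estimate yields the same power
  \<open>(\<gamma> * t / P) powr (- r)\<close> for every \<open>j\<close>, whatever
  \<open>p j\<close> is. The bound is uniform in \<open>N\<close> and \<open>I\<close> because
  \<open>dlen I\<close> serves only as the a priori bound of the iteration.\<close>

lemma measure_exceed_set_weak:
  assumes "0 < s"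
  shows "measure lebesgue (exceed_set c e (\<lambda>_. True) s N I 0) \<le>
    2 * 2 powr r * (\<Sum>j<m. 2 powr p j) * \<gamma> powr (- r) * P powr r * s powr (- r)"
proof -
  have "measure lebesgue (exceed_set c e (\<lambda>_. True) s N I 0) \<le>
      2 * 2 powr r * ((\<Sum>j<m. 2 powr p j) * (\<gamma> / P) powr (- r)) * s powr (- r)"
  proof (rule iterate_weak[where A="dlen I" and d="8 * real m * B * \<gamma>"])
    fix t :: real assume t: "0 < t"
    have y: "0 < \<gamma> * t / P" using t P_pos \<gamma>_pos by simp
    have "measure lebesgue (maximal_set (A j) (H t j) N I) \<le> 2 powr p j * (\<gamma> * t / P) powr (- r)" if "j < m" for j
    proof -
      have pj: "0 < p j" using p[OF that] by simp
      have "measure lebesgue (maximal_set (A j) (H t j) N I) \<le> (2 / H t j) powr p j * Lp_norm (p j) (f j) powr p j"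
        using that t by (intro measure_maximal_set_weak fL p H_pos)
      also have "\<dots> = 2 powr p j * (Lp_norm (p j) (f j) / H t j) powr p j"
        using fN[OF that] H_pos[OF t that] by (simp add: powr_divide)
      also have "Lp_norm (p j) (f j) / H t j = (\<gamma> * t / P) powr (- r / p j)"
        using fN[OF that] y by (simp add: H_def powr_minus_divide)
      also have "\<dots> powr p j = (\<gamma> * t / P) powr (- r)"
        using pj by (simp add: powr_powr)
      finally show ?thesis .
    qed
    hence "(\<Sum>j<m. measure lebesgue (maximal_set (A j) (H t j) N I)) \<le>
        (\<Sum>j<m. 2 powr p j * (\<gamma> * t / P) powr (- r))"
      by (intro sum_mono) auto
    also have "\<dots> = (\<Sum>j<m. 2 powr p j) * ((\<gamma> / P) * t) powr (- r)"
      by (simp add: sum_distrib_right)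
    also have "((\<gamma> / P) * t) powr (- r) = (\<gamma> / P) powr (- r) * t powr (- r)"
      using t P_pos \<gamma>_pos by (intro powr_mult)
    finally show "measure lebesgue (exceed_set c e (\<lambda>_. True) (2 * t) N I 0) \<le>
        8 * real m * B * \<gamma> * measure lebesgue (exceed_set c e (\<lambda>_. True) t N I 0) +
        (\<Sum>j<m. 2 powr p j) * (\<gamma> / P) powr (- r) * t powr (- r)"
      using good_lambda_H[OF t, of N I] by simp
  qed (use assms r_pos \<gamma>_small measure_exceed_set_le in auto)
  also have "(\<gamma> / P) powr (- r) = \<gamma> powr (- r) * P powr r"
    using P_pos \<gamma>_pos by (simp add: powr_divide powr_minus field_simps)
  finally show ?thesis by (simp add: mult.assoc)
qed

text \<open>After division by \<open>P\<close> the levels are \<open>P * 2 powr k\<close>. The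
  thresholds for index \<open>l\<close> then form a progression of ratio
  \<open>2 powr (r / p l)\<close>, and the weight \<open>2 powr (r * k)\<close> is this ratio to the
  power \<open>k * p l\<close>: exactly the shape required by
  \<open>sum_measure_maximal_set_strong\<close>.\<close>

lemma nn_integral_path_sum_strong:
  assumes p1: "\<And>j. j < m \<Longrightarrow> 1 < p j"
  defines "Q \<equiv> (\<lambda>j. (2 powr (r / p j)) powr (p j - 1))"
  shows "(\<integral>\<^sup>+x. indicator (dint I) x * ennreal (\<bar>path_sum c e N (fst I) x / P\<bar> powr r) \<partial>lebesgue) \<le>
    ennreal (2 powr r * (2 * 2 powr r * (\<Sum>j<m. Q j / (Q j - 1) * (2 powr p j * \<gamma> powr (- r)))))"
proof (rule nn_integral_powr_le_sum)
  have Q: "1 < Q j" if "j < m" for j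
    unfolding Q_def using p1[OF that] r_pos by (intro gr_one_powr) auto
  have bnn: "0 \<le> (\<Sum>j<m. Q j / (Q j - 1) * (2 powr p j * \<gamma> powr (- r)))"
  proof (rule sum_nonneg)
    fix j assume "j \<in> {..<m}"
    thus "0 \<le> Q j / (Q j - 1) * (2 powr p j * \<gamma> powr (- r))"
      using Q[of j] by (intro mult_nonneg_nonneg divide_nonneg_nonneg) auto
  qed
  thus "0 \<le> 2 * 2 powr r * (\<Sum>j<m. Q j / (Q j - 1) * (2 powr p j * \<gamma> powr (- r)))"
    by simp
  define a where "a k = measure lebesgue (exceed_set c e (\<lambda>_. True) (P * 2 powr real_of_int k) N I 0)" for k
  define b where "b k = (\<Sum>j<m. measure lebesgue (maximal_set (A j) (H (P * 2 powr real_of_int k) j) N I))" for k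
  fix i j :: int
  have "(\<Sum>k\<in>{i..j}. 2 powr (r * real_of_int k) *
      measure lebesgue {x \<in> dint I. 2 powr real_of_int k < \<bar>path_sum c e N (fst I) x / P\<bar>}) \<le>
      (\<Sum>k\<in>{i..j}. 2 powr (r * real_of_int k) * a k)"
  proof (intro sum_mono mult_left_mono)
    fix k
    have "{x \<in> dint I. y < \<bar>path_sum c e N (fst I) x\<bar>} \<in> lmeasurable" for y
    proof -
      have "{x. y < \<bar>path_sum c e N (fst I) x\<bar>} \<in> sets lebesgue"
        using borel_measurable_less[of "\<lambda>_. y" lebesgue "\<lambda>x. \<bar>path_sum c e N (fst I) x\<bar>"]
          borel_measurable_abs[OF path_sum_measurable] by simp
      from fmeasurable_Int_fmeasurable[OF dint_lmeasurable[of I] this] show ?thesis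
        by (simp add: Int_def)
    qed
    moreover have eq: "{x \<in> dint I. 2 powr real_of_int k < \<bar>path_sum c e N (fst I) x / P\<bar>} =
       {x \<in> dint I. P * 2 powr real_of_int k < \<bar>path_sum c e N (fst I) x\<bar>}"
      using P_pos by (auto simp: abs_divide field_simps)
    moreover have "{x \<in> dint I. P * 2 powr real_of_int k < \<bar>path_sum c e N (fst I) x\<bar>} \<subseteq>
        exceed_set c e (\<lambda>_. True) (P * 2 powr real_of_int k) N I 0"
      by (auto simp: mem_exceed_set)
    ultimately show "measure lebesgue {x \<in> dint I. 2 powr real_of_int k < \<bar>path_sum c e N (fst I) x / P\<bar>} \<le> a k"
      unfolding a_def by (intro measure_mono_fmeasurable) (auto simp: exceed_set_lmeasurable fmeasurableD)
  qed simp
  also have "\<dots> \<le> 2 * 2 powr r * (\<Sum>j<m. Q j / (Q j - 1) * (2 powr p j * \<gamma> powr (- r)))"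
  proof (rule iterate_strong[where A="dlen I" and d="8 * real m * B * \<gamma>" and b=b])
    show "0 < r" by (rule r_pos)
    show "a k \<le> dlen I" "0 \<le> a k" "0 \<le> b k" for k
      by (simp_all add: a_def b_def measure_exceed_set_le sum_nonneg)
    show "8 * real m * B * \<gamma> * 2 powr r \<le> 1 / 2" by (rule \<gamma>_small)
    show "a (k + 1) \<le> 8 * real m * B * \<gamma> * a k + b k" for k
      using good_lambda_H[of "P * 2 powr real_of_int k" N I] P_pos
      by (simp add: a_def b_def powr_add mult.assoc mult.left_commute[of 2] mult.commute[of _ 2])
    fix i j :: int
    have "(\<Sum>k\<in>{i..j}. 2 powr (r * real_of_int k) * b k) =
      (\<Sum>l<m. \<Sum>k\<in>{i..j}. 2 powr (r * real_of_int k) * measure lebesgue (maximal_set (A l) (H (P * 2 powr real_of_int k) l) N I))"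
      unfolding b_def sum_distrib_left by (rule sum.swap)
    also have "\<dots> \<le> (\<Sum>l<m. Q l / (Q l - 1) * (2 powr p l * \<gamma> powr (- r)))"
    proof (rule sum_mono)
      fix l assume "l \<in> {..<m}"
      hence l: "l < m" by simp
      have pl: "0 < p l" using p[OF l] by simp
      define N0 where "N0 = Lp_norm (p l) (f l)"
      have N0: "0 < N0" using fN[OF l] by (simp add: N0_def)
      define y where "y = N0 * \<gamma> powr (r / p l)"
      have y: "0 < y" using N0 \<gamma>_pos by (simp add: y_def)
      have Hy: "H (P * 2 powr real_of_int k) l = y * (2 powr (r / p l)) powr real_of_int k" for k
      proof -
        have "\<gamma> * (P * 2 powr real_of_int k) / P = \<gamma> * 2 powr real_of_int k" using P_pos by simp
        thus ?thesis using \<gamma>_pos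
          by (simp add: H_def y_def N0_def powr_mult powr_powr mult.commute[of r])
      qed
      have w: "2 powr (r * real_of_int k) = (2 powr (r / p l)) powr (real_of_int k * p l)" for k
        using pl by (simp add: powr_powr)
      have "(\<Sum>k\<in>{i..j}. 2 powr (r * real_of_int k) * measure lebesgue (maximal_set (A l) (H (P * 2 powr real_of_int k) l) N I))
          \<le> Q l / (Q l - 1) * (2 / y) powr p l * Lp_norm (p l) (f l) powr p l"
        unfolding Hy w Q_def
        using l p1 y r_pos pl by (intro sum_measure_maximal_set_strong fL) (auto intro!: gr_one_powr)
      also have "\<dots> = Q l / (Q l - 1) * (2 powr p l * (N0 / y) powr p l)"
        using y N0 by (simp add: powr_divide N0_def)
      also have "N0 / y = \<gamma> powr (- r / p l)" using N0 by (simp add: y_def powr_minus_divide)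
      also have "\<dots> powr p l = \<gamma> powr (- r)" using pl by (simp add: powr_powr)
      finally show "(\<Sum>k\<in>{i..j}. 2 powr (r * real_of_int k) * measure lebesgue (maximal_set (A l) (H (P * 2 powr real_of_int k) l) N I))
          \<le> Q l / (Q l - 1) * (2 powr p l * \<gamma> powr (- r))" .
    qed
    finally show "(\<Sum>k\<in>{i..j}. 2 powr (r * real_of_int k) * b k) \<le>
        (\<Sum>j<m. Q j / (Q j - 1) * (2 powr p j * \<gamma> powr (- r)))" .
  qed
  finally show "(\<Sum>k\<in>{i..j}. 2 powr (r * real_of_int k) *
      measure lebesgue {x \<in> dint I. 2 powr real_of_int k < \<bar>path_sum c e N (fst I) x / P\<bar>}) \<le>
      2 * 2 powr r * (\<Sum>j<m. Q j / (Q j - 1) * (2 powr p j * \<gamma> powr (- r)))" .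
qed (use path_sum_measurable r_pos dint_lmeasurable in \<open>auto intro: borel_measurable_divide\<close>)

end

section \<open>Almost everywhere convergence\<close>

lemma emeasure_UN_le:
  assumes "incseq F" "\<And>n. F n \<in> lmeasurable" "\<And>n. measure lebesgue (F n) \<le> b"
  shows "emeasure lebesgue (\<Union>n. F n) \<le> ennreal b"
proof -
  have "emeasure lebesgue (\<Union>n. F n) = (SUP n. emeasure lebesgue (F n))"
    using assms by (intro SUP_emeasure_incseq[symmetric]) (auto simp: fmeasurableD)
  also have "\<dots> \<le> ennreal b"
    using assms by (intro SUP_least) (auto simp: emeasure_eq_measure2 intro!: ennreal_leI)
  finally show ?thesis .
qed

lemma null_setsI_tendsto:
  assumes "S \<in> sets lebesgue" "\<And>n. emeasure lebesgue S \<le> ennreal (b n)" "b \<longlonglongrightarrow> 0"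
  shows "S \<in> null_sets lebesgue"
proof -
  have "(\<lambda>n. ennreal (b n)) \<longlonglongrightarrow> ennreal 0" using assms(3) by (rule tendsto_ennrealI)
  hence "emeasure lebesgue S \<le> ennreal 0" using assms(2) by (intro LIMSEQ_le_const) auto
  thus ?thesis using assms(1) by (auto intro: null_setsI)
qed

lemma nn_integral_fatou_AE:
  fixes u :: "nat \<Rightarrow> real \<Rightarrow> ennreal"
  assumes "\<And>n. u n \<in> borel_measurable lebesgue" "AE x in lebesgue. v x \<le> liminf (\<lambda>n. u n x)"
    "\<And>n. (\<integral>\<^sup>+x. u n x \<partial>lebesgue) \<le> b"
  shows "(\<integral>\<^sup>+x. v x \<partial>lebesgue) \<le> b"
proof -
  have "(\<integral>\<^sup>+x. v x \<partial>lebesgue) \<le> (\<integral>\<^sup>+x. liminf (\<lambda>n. u n x) \<partial>lebesgue)"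
    by (rule nn_integral_mono_AE) (rule assms(2))
  also have "\<dots> \<le> liminf (\<lambda>n. \<integral>\<^sup>+x. u n x \<partial>lebesgue)"
    by (rule nn_integral_liminf) (rule assms(1))
  also have "\<dots> \<le> liminf (\<lambda>n. b)"
    by (intro Liminf_mono always_eventually allI assms(3))
  finally show ?thesis by (simp add: Liminf_const)
qed

text \<open>No dyadic interval has points on both sides of 0, so the line is exhausted by two
  growing sequences of intervals. This is the origin of the factor 2 in the global
  estimates.\<close>

lemma eventually_mem_dint:
  fixes x :: real
  shows "\<forall>\<^sub>F M in sequentially. x \<in> dint (- int M, 0) \<union> dint (- int M, -1)"
proof (rule eventually_sequentiallyI)
  fix M assume M: "nat \<lceil>\<bar>x\<bar>\<rceil> \<le> M"
  have "\<bar>x\<bar> \<le> real M" using M by linarith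
  also have "\<dots> < 2 ^ M" using of_nat_less_two_power[of M] by simp
  also have "\<dots> = 2 powr real M" by (simp add: powr_realpow)
  finally show "x \<in> dint (- int M, 0) \<union> dint (- int M, -1)"
    by (auto simp: dint_def)
qed

lemma abs_branch_term_le: "\<bar>e\<bar> = 1 \<Longrightarrow> \<bar>branch_term c e I x\<bar> = \<bar>c I\<bar>"
  by (simp add: branch_term_def abs_mult)

context haar_setup
begin

text \<open>The energies increase with depth and are bounded, hence converge to some
  \<open>L\<close>; oscillation beyond generation \<open>n\<close> costs at most the remaining
  energy \<open>L - Q n\<close>.\<close>

lemma null_oscillation:
  assumes H: "\<And>j. j < m \<Longrightarrow> 0 < H j" and s: "0 < s"
  shows "(\<Inter>n. \<Union>N. tail_exceed_set c e (good H) s n N J) \<in> null_sets lebesgue"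
proof -
  define Q where "Q n = tree_energy (\<lambda>I. \<bar>c I\<bar> ^ q) (good H) n J" for n
  have inc: "incseq Q"
    unfolding Q_def by (intro incseq_SucI tree_energy_mono_Suc) simp
  obtain L where L: "Q \<longlonglongrightarrow> L" "\<And>n. Q n \<le> L"
    using incseq_convergent[OF inc, of "4 * real m * (B * (\<Prod>j<m. H j)) ^ q * dlen J"]
      tree_energy_bound[of H _ J, OF H] unfolding Q_def by blast
  have sets: "(\<Union>N. tail_exceed_set c e (good H) s n N J) \<in> sets lebesgue" for n
    by (intro sets.countable_UN) (auto simp: tail_exceed_set_lmeasurable fmeasurableD)
  have bound: "emeasure lebesgue (\<Union>N. tail_exceed_set c e (good H) s n N J) \<le> ennreal ((L - Q n) / s ^ q)" for n
  proof (rule emeasure_UN_le)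
    show "incseq (\<lambda>N. tail_exceed_set c e (good H) s n N J)" by (simp add: incseq_def tail_exceed_set_mono)
    fix N
    have "s ^ q * measure lebesgue (tail_exceed_set c e (good H) s n N J) \<le> Q (N + n) - Q n"
      unfolding Q_def using s by (intro measure_tail_exceed_set_le[OF parallelogram] q_pos) auto
    also have "\<dots> \<le> L - Q n" using L(2)[of "N + n"] by simp
    finally show "measure lebesgue (tail_exceed_set c e (good H) s n N J) \<le> (L - Q n) / s ^ q"
      using s by (simp add: field_simps)
  qed (rule tail_exceed_set_lmeasurable)
  show ?thesis
  proof (rule null_setsI_tendsto)
    show "(\<Inter>n. \<Union>N. tail_exceed_set c e (good H) s n N J) \<in> sets lebesgue"
      using sets by (intro sets.countable_INT) auto
    show "emeasure lebesgue (\<Inter>n. \<Union>N. tail_exceed_set c e (good H) s n N J) \<le> ennreal ((L - Q n) / s ^ q)" for n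
      by (rule order_trans[OF emeasure_mono bound]) (use sets in auto)
    have "(\<lambda>n. (L - Q n) / s ^ q) \<longlonglongrightarrow> (L - L) / s ^ q"
      using s by (intro tendsto_intros L) auto
    thus "(\<lambda>n. (L - Q n) / s ^ q) \<longlonglongrightarrow> 0" by simp
  qed
qed

text \<open>Weak type (1,1) at the levels \<open>Suc h\<close> bounds the measure by a multiple of
  \<open>1 / real (Suc h)\<close>. Hence almost every path is good for some constant
  threshold.\<close>

lemma null_unbounded:
  "(\<Inter>h::nat. \<Union>j\<in>{..<m}. \<Union>N. maximal_set (A j) (real (Suc h)) N J) \<in> null_sets lebesgue"
proof (rule null_setsI_tendsto)
  have sets: "(\<Union>N. maximal_set (A j) y N J) \<in> sets lebesgue" for j y
    by (intro sets.countable_UN) (auto simp: maximal_set_lmeasurable fmeasurableD)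
  have sets': "(\<Union>j\<in>{..<m}. \<Union>N. maximal_set (A j) y N J) \<in> sets lebesgue" for y
    by (rule sets.finite_UN) (use sets in auto)
  show "(\<Inter>h::nat. \<Union>j\<in>{..<m}. \<Union>N. maximal_set (A j) (real (Suc h)) N J) \<in> sets lebesgue"
    using sets' by (intro sets.countable_INT) auto
  fix h
  have b: "emeasure lebesgue (\<Union>N. maximal_set (A j) (real (Suc h)) N J) \<le> ennreal (dlen J * A j J / real (Suc h))"
    if "j < m" for j
  proof (rule emeasure_UN_le)
    show "incseq (\<lambda>N. maximal_set (A j) (real (Suc h)) N J)" by (simp add: incseq_def maximal_set_mono)
    show "measure lebesgue (maximal_set (A j) (real (Suc h)) N J) \<le> dlen J * A j J / real (Suc h)" for N
      using measure_maximal_set_le[of "A j" "real (Suc h)" N J, OF avg_children[OF locint_abs[OF f[OF that]]] avg_abs_nonneg]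
      by (simp add: pos_le_divide_eq mult.commute del: of_nat_Suc)
  qed (rule maximal_set_lmeasurable)
  have "emeasure lebesgue (\<Inter>h::nat. \<Union>j\<in>{..<m}. \<Union>N. maximal_set (A j) (real (Suc h)) N J) \<le>
      emeasure lebesgue (\<Union>j\<in>{..<m}. \<Union>N. maximal_set (A j) (real (Suc h)) N J)"
    by (rule emeasure_mono) (use sets' in auto)
  also have "\<dots> \<le> (\<Sum>j<m. emeasure lebesgue (\<Union>N. maximal_set (A j) (real (Suc h)) N J))"
    by (rule emeasure_subadditive_finite) (use sets in auto)
  also have "\<dots> \<le> (\<Sum>j<m. ennreal (dlen J * A j J / real (Suc h)))"
    by (intro sum_mono b) simp
  also have "\<dots> = ennreal (\<Sum>j<m. dlen J * A j J / real (Suc h))"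
    by (rule sum_ennreal) (auto intro!: divide_nonneg_nonneg mult_nonneg_nonneg avg_abs_nonneg)
  also have "(\<Sum>j<m. dlen J * A j J / real (Suc h)) = (\<Sum>j<m. dlen J * A j J) / real (Suc h)"
    by (rule sum_divide_distrib[symmetric])
  finally show "emeasure lebesgue (\<Inter>h::nat. \<Union>j\<in>{..<m}. \<Union>N. maximal_set (A j) (real (Suc h)) N J) \<le>
      ennreal ((\<Sum>j<m. dlen J * A j J) / real (Suc h))" .
next
  show "(\<lambda>h. (\<Sum>j<m. dlen J * A j J) / real (Suc h)) \<longlonglongrightarrow> 0"
    using LIMSEQ_Suc[OF lim_const_over_n[of "\<Sum>j<m. dlen J * A j J"]] by simp
qed

text \<open>One threshold for which the whole path is good makes the stopping rule inactive, so the
  tail sets describe the actual path sums: from some generation on they stay within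
  \<open>1 / real (Suc i)\<close> of a fixed value, for each \<open>i\<close>.\<close>

lemma convergent_fine:
  assumes x: "x \<in> dint J" "fst J = 0"
    and b: "x \<notin> (\<Inter>h::nat. \<Union>j\<in>{..<m}. \<Union>N. maximal_set (A j) (real (Suc h)) N J)"
    and o: "\<And>h i::nat. x \<notin> (\<Inter>n. \<Union>N. tail_exceed_set c e (good (\<lambda>_. real (Suc h))) (1 / real (Suc i)) n N J)"
  shows "convergent (\<lambda>N. path_sum c e N 0 x)"
proof -
  from b obtain h where h: "\<And>j N. j < m \<Longrightarrow> x \<notin> maximal_set (A j) (real (Suc h)) N J" by auto
  let ?g = "good (\<lambda>_. real (Suc h))"
  have g: "?g (dyad (int l) x)" for l
    unfolding good_def
  proof (intro allI impI)
    fix j assume "j < m"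
    from h[OF this, of l] show "A j (dyad (int l) x) \<le> real (Suc h)"
      unfolding mem_maximal_set[OF x(1)] x(2) by (auto simp: not_less simp del: of_nat_Suc)
  qed
  have osc: "\<exists>n. \<forall>N. \<bar>path_sum c e (n + N) 0 x - path_sum c e n 0 x\<bar> \<le> 1 / real (Suc i)" for i
  proof -
    from o[of h i] obtain n where n: "\<And>N. x \<notin> tail_exceed_set c e ?g (1 / real (Suc i)) n N J" by auto
    have "\<bar>path_sum c e (n + N) 0 x - path_sum c e n 0 x\<bar> \<le> 1 / real (Suc i)" for N
    proof (rule ccontr)
      assume "\<not> ?thesis"
      hence "1 / real (Suc i) < \<bar>0 + path_sum c e N (int n) x\<bar>" unfolding path_sum_add by simp
      moreover have "?g (dyad (int n + int l) x)" for l using g[of "n + l"] by simp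
      ultimately have "x \<in> exceed_set c e ?g (1 / real (Suc i)) N (dyad (int n) x) 0"
        unfolding mem_exceed_set[OF mem_dint_dyad] fst_dyad by blast
      hence "x \<in> tail_exceed_set c e ?g (1 / real (Suc i)) n N J"
        using x g by (intro mem_tail_exceed_set) auto
      thus False using n by blast
    qed
    thus ?thesis by blast
  qed
  have "Cauchy (\<lambda>N. path_sum c e N 0 x)"
  proof (rule metric_CauchyI)
    fix \<delta> :: real assume "0 < \<delta>"
    then obtain i where i: "1 / real (Suc i) < \<delta> / 2"
      using reals_Archimedean[of "\<delta> / 2"] by (auto simp: inverse_eq_divide)
    obtain n where n: "\<And>N. \<bar>path_sum c e (n + N) 0 x - path_sum c e n 0 x\<bar> \<le> 1 / real (Suc i)"
      using osc by blast
    have n': "\<bar>path_sum c e N 0 x - path_sum c e n 0 x\<bar> < \<delta> / 2" if "n \<le> N" for N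
      using n[of "N - n"] i that by simp
    show "\<exists>M. \<forall>N\<ge>M. \<forall>N'\<ge>M. dist (path_sum c e N 0 x) (path_sum c e N' 0 x) < \<delta>"
    proof (intro exI[of _ n] allI impI)
      fix N N' assume "n \<le> N" "n \<le> N'"
      from n'[OF this(1)] n'[OF this(2)] show "dist (path_sum c e N 0 x) (path_sum c e N' 0 x) < \<delta>"
        unfolding dist_real_def by linarith
    qed
  qed
  thus ?thesis by (simp add: Cauchy_convergent_iff)
qed

lemma AE_convergent_fine: "AE x in lebesgue. convergent (\<lambda>N. path_sum c e N 0 x)"
proof -
  \<comment> \<open>A countable union over unit intervals, integer thresholds and reciprocal
    tolerances, hence still null.\<close>
  define Z where "Z = (\<Union>k::int. (\<Inter>h::nat. \<Union>j\<in>{..<m}. \<Union>N. maximal_set (A j) (real (Suc h)) N (0, k)) \<union>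
    (\<Union>h::nat. \<Union>i::nat. \<Inter>n. \<Union>N. tail_exceed_set c e (good (\<lambda>_. real (Suc h))) (1 / real (Suc i)) n N (0, k)))"
  have Z: "Z \<in> null_sets lebesgue"
    unfolding Z_def by (intro null_sets_UN null_sets.Un null_unbounded null_oscillation) auto
  show ?thesis
  proof (rule AE_I'[OF Z], rule subsetI)
    fix x assume x: "x \<in> {x \<in> space lebesgue. \<not> convergent (\<lambda>N. path_sum c e N 0 x)}"
    obtain k where k: "dyad 0 x = (0, k)" by (simp add: dyad_def)
    hence "x \<in> dint (0, k)" by (simp add: mem_dint_iff)
    show "x \<in> Z"
    proof (rule ccontr)
      assume "x \<notin> Z"
      hence "convergent (\<lambda>N. path_sum c e N 0 x)"
      proof (intro convergent_fine[OF \<open>x \<in> dint (0, k)\<close>])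
        show "x \<notin> (\<Inter>h::nat. \<Union>j\<in>{..<m}. \<Union>N. maximal_set (A j) (real (Suc h)) N (0, k))"
          using \<open>x \<notin> Z\<close> unfolding Z_def by (meson UNIV_I UN_I UnI1)
        show "x \<notin> (\<Inter>n. \<Union>N. tail_exceed_set c e (good (\<lambda>_. real (Suc h))) (1 / real (Suc i)) n N (0, k))" for h i
          using \<open>x \<notin> Z\<close> unfolding Z_def by (meson UNIV_I UN_I UnI2)
      qed simp
      thus False using x by simp
    qed
  qed
qed

end

context haar_setup_Lp
begin

lemma abs_c_decay: "\<bar>c I\<bar> \<le> B * 2 ^ m * P * dlen I powr (- 1 / r)"
proof -
  have "\<bar>c I\<bar> \<le> B * (\<Prod>j<m. 2 * Lp_norm (p j) (f j) * dlen I powr (- 1 / p j))"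
    by (intro abs_c_le avg_le_Lp_norm fL p fN)
  also have "(\<Prod>j<m. 2 * Lp_norm (p j) (f j) * dlen I powr (- 1 / p j)) =
      2 ^ m * P * (\<Prod>j<m. dlen I powr (- 1 / p j))"
    by (simp add: prod.distrib P_def)
  also have "(\<Prod>j<m. dlen I powr (- 1 / p j)) = dlen I powr (\<Sum>j<m. - 1 / p j)"
    by (intro powr_sum[symmetric]) simp
  also have "(\<Sum>j<m. - 1 / p j) = - 1 / r"
    using pr by (simp add: sum_negf)
  finally show ?thesis by (simp add: mult.assoc)
qed

text \<open>Long intervals have small averages: the terms decay geometrically with ratio
  \<open>2 powr (- 1 / r)\<close>, so convergence is absolute and holds at every point.\<close>

lemma convergent_coarse: "convergent (\<lambda>N. path_sum c e N (- int N) x)"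
proof -
  have "path_sum c e N (- int N) x = (\<Sum>i<N. branch_term c e (dyad (- int (Suc i)) x) x)" for N
  proof -
    \<comment> \<open>The starting generation moves with \<open>N\<close>; reversing the order
      yields the partial sums of one fixed series.\<close>
    have "path_sum c e N (- int N) x = (\<Sum>l<N. branch_term c e (dyad (- int N + int (N - Suc l)) x) x)"
      unfolding path_sum_def by (rule sum.nat_diff_reindex[symmetric])
    also have "\<dots> = (\<Sum>i<N. branch_term c e (dyad (- int (Suc i)) x) x)"
      by (intro sum.cong) (auto simp: of_nat_diff)
    finally show ?thesis .
  qed
  moreover have "summable (\<lambda>i. branch_term c e (dyad (- int (Suc i)) x) x)"
  proof (rule summable_comparison_test)
    have "summable (\<lambda>i. (2 powr (- 1 / r)) ^ i)"
      using r_pos by (intro summable_geometric) (auto simp: powr_less_one)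
    thus "summable (\<lambda>i. B * 2 ^ m * P * (2 powr (- 1 / r) * (2 powr (- 1 / r)) ^ i))"
      by (intro summable_mult)
    show "\<exists>N. \<forall>n\<ge>N. norm (branch_term c e (dyad (- int (Suc n)) x) x) \<le>
        B * 2 ^ m * P * (2 powr (- 1 / r) * (2 powr (- 1 / r)) ^ n)"
    proof (intro exI[of _ 0] allI impI)
      fix n
      have "dlen (dyad (- int (Suc n)) x) powr (- 1 / r) = 2 powr (- 1 / r) * (2 powr (- 1 / r)) ^ n"
      proof -
        have "dlen (dyad (- int (Suc n)) x) powr (- 1 / r) = 2 powr (- 1 / r + real n * (- 1 / r))"
          by (simp add: dlen_eq powr_powr add_divide_distrib add.commute)
        also have "\<dots> = 2 powr (- 1 / r) * (2 powr (- 1 / r)) ^ n"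
          unfolding powr_add by (subst powr_power) (simp_all add: mult.commute)
        finally show ?thesis .
      qed
      thus "norm (branch_term c e (dyad (- int (Suc n)) x) x) \<le>
          B * 2 ^ m * P * (2 powr (- 1 / r) * (2 powr (- 1 / r)) ^ n)"
        using abs_c_decay[of "dyad (- int (Suc n)) x"] by (simp add: abs_branch_term_le power_abs)
    qed
  qed
  ultimately show ?thesis by (simp add: summable_iff_convergent)
qed

lemma AE_convergent:
  "AE x in lebesgue. (\<lambda>N. path_sum c e (2 * N + 1) (- int N) x) \<longlonglongrightarrow> haar_mult \<epsilon> \<alpha> f x"
  using AE_convergent_fine
proof eventually_elim
  case (elim x)
  \<comment> \<open>Of the \<open>2 * N + 1\<close> generations, \<open>N\<close> are coarse (from
    -N to -1) and \<open>N + 1\<close> are fine (from 0 to N).\<close>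
  have eq: "path_sum c e (2 * N + 1) (- int N) x = path_sum c e N (- int N) x + path_sum c e (Suc N) 0 x" for N
    using path_sum_add[of c e N "Suc N" "- int N" x] by (simp add: mult_2)
  have "convergent (\<lambda>N. path_sum c e (Suc N) 0 x)"
    using elim convergent_ignore_initial_segment[of "\<lambda>N. path_sum c e N 0 x" 1] by simp
  hence "convergent (\<lambda>N. path_sum c e (2 * N + 1) (- int N) x)"
    unfolding eq by (intro convergent_add convergent_coarse)
  thus ?case
    using haar_mult_eq[of \<alpha> f \<epsilon> x] f len sig by (simp add: convergent_LIMSEQ_iff)
qed

lemma haar_mult_measurable: "haar_mult \<epsilon> \<alpha> f \<in> borel_measurable lebesgue"
proof -
  have "haar_mult \<epsilon> \<alpha> f = (\<lambda>x. lim (\<lambda>N. path_sum c e (2 * N + 1) (- int N) x))"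
    using haar_mult_eq[of \<alpha> f \<epsilon>] f len sig by auto
  moreover have "(\<lambda>x. lim (\<lambda>N. path_sum c e (2 * N + 1) (- int N) x)) \<in> borel_measurable lebesgue"
    by (rule borel_measurable_lim_metric) (rule path_sum_measurable)
  ultimately show ?thesis by simp
qed

lemma emeasure_haar_mult_weak:
  assumes s: "0 < s"
  shows "emeasure lebesgue {x. s < \<bar>haar_mult \<epsilon> \<alpha> f x\<bar>} \<le>
    ennreal (2 * (2 * 2 powr r * (\<Sum>j<m. 2 powr p j) * \<gamma> powr (- r) * P powr r * s powr (- r)))"
proof -
  let ?T = "haar_mult \<epsilon> \<alpha> f"
  let ?K = "2 * 2 powr r * (\<Sum>j<m. 2 powr p j) * \<gamma> powr (- r) * P powr r * s powr (- r)"
  define G where "G M k = exceed_set c e (\<lambda>_. True) s (2 * M + 1) (- int M, k) 0" for M :: nat and k :: int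
  have Gm: "G M k \<in> sets lebesgue" for M k
    unfolding G_def by (rule fmeasurableD[OF exceed_set_lmeasurable])
  have S: "{x. s < \<bar>?T x\<bar>} \<in> sets lebesgue"
    using borel_measurable_less[of "\<lambda>_. s" lebesgue "\<lambda>x. \<bar>?T x\<bar>"]
      borel_measurable_abs[OF haar_mult_measurable] by simp
  have GK: "emeasure lebesgue (G M k) \<le> ennreal ?K" for M k
    using measure_exceed_set_weak[OF s, of "2 * M + 1" "(- int M, k)"] unfolding G_def
    by (subst emeasure_eq_measure2[OF exceed_set_lmeasurable]) (rule ennreal_leI)
  have K0: "0 \<le> ?K" by (intro mult_nonneg_nonneg sum_nonneg) auto
  have "(\<integral>\<^sup>+x. indicator {x. s < \<bar>?T x\<bar>} x \<partial>lebesgue) \<le> ennreal ?K + ennreal ?K"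
  proof (rule nn_integral_fatou_AE)
    show "(\<lambda>x. indicator (G M 0 \<union> G M (-1)) x) \<in> borel_measurable lebesgue" for M
      using Gm by (intro borel_measurable_indicator sets.Un)
    show "(\<integral>\<^sup>+x. indicator (G M 0 \<union> G M (-1)) x \<partial>lebesgue) \<le> ennreal ?K + ennreal ?K" for M
    proof -
      have "(\<integral>\<^sup>+x. indicator (G M 0 \<union> G M (-1)) x \<partial>lebesgue) = emeasure lebesgue (G M 0 \<union> G M (-1))"
        using Gm by (intro nn_integral_indicator sets.Un)
      also have "\<dots> \<le> emeasure lebesgue (G M 0) + emeasure lebesgue (G M (-1))"
        using Gm by (intro emeasure_subadditive)
      also have "\<dots> \<le> ennreal ?K + ennreal ?K" by (intro add_mono GK)
      finally show ?thesis .
    qed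
    show "AE x in lebesgue. indicator {x. s < \<bar>?T x\<bar>} x \<le>
        liminf (\<lambda>M. indicator (G M 0 \<union> G M (-1)) x :: ennreal)"
      using AE_convergent
    proof eventually_elim
      case (elim x)
      show ?case
      proof (cases "s < \<bar>?T x\<bar>")
        case True
        \<comment> \<open>The inequality at the limit is strict, so it holds for all late truncated
          sums and places \<open>x\<close> in their exceedance sets; this is the pointwise
          hypothesis of Fatou's lemma.\<close>
        have "\<forall>\<^sub>F M in sequentially. s < \<bar>path_sum c e (2 * M + 1) (- int M) x\<bar>"
          using tendsto_rabs[OF elim] True by (rule order_tendstoD(1))
        hence "\<forall>\<^sub>F M in sequentially. 1 \<le> (indicator (G M 0 \<union> G M (-1)) x :: ennreal)"
          using eventually_mem_dint[of x]
        proof eventually_elim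
          case (elim M)
          have "x \<in> G M k" if "x \<in> dint (- int M, k)" for k
            unfolding G_def mem_exceed_set[OF that] using elim(1) by (intro exI[of _ "2 * M + 1"]) simp
          thus ?case using elim(2) by (auto simp: indicator_def)
        qed
        thus ?thesis using True by (auto intro: Liminf_bounded)
      qed simp
    qed
  qed
  also have "ennreal ?K + ennreal ?K = ennreal (2 * ?K)"
    using K0 by (subst ennreal_plus[symmetric]) auto
  finally show ?thesis using S by (simp add: nn_integral_indicator)
qed

lemma nn_integral_haar_mult_strong:
  assumes K: "\<And>N I. (\<integral>\<^sup>+x. indicator (dint I) x * ennreal (\<bar>path_sum c e N (fst I) x / P\<bar> powr r) \<partial>lebesgue)
      \<le> ennreal K" and K0: "0 \<le> K"
  shows "(\<integral>\<^sup>+x. ennreal (\<bar>haar_mult \<epsilon> \<alpha> f x / P\<bar> powr r) \<partial>lebesgue) \<le> ennreal (2 * K)"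
proof -
  let ?T = "haar_mult \<epsilon> \<alpha> f"
  define u where "u M x = ennreal (\<bar>path_sum c e (2 * M + 1) (- int M) x / P\<bar> powr r)" for M :: nat and x
  have um: "u M \<in> borel_measurable lebesgue" for M
    unfolding u_def
    by (intro measurable_compose[OF _ measurable_ennreal] powr_real_measurable borel_measurable_abs
        borel_measurable_divide path_sum_measurable borel_measurable_const)
  have um': "(\<lambda>x. indicator (dint I) x * u M x) \<in> borel_measurable lebesgue" for M I
    by (intro borel_measurable_times_ennreal borel_measurable_indicator um) simp
  have "(\<integral>\<^sup>+x. ennreal (\<bar>?T x / P\<bar> powr r) \<partial>lebesgue) \<le> ennreal K + ennreal K"
  proof (rule nn_integral_fatou_AE)
    show "(\<lambda>x. indicator (dint (- int M, 0)) x * u M x + indicator (dint (- int M, -1)) x * u M x) \<in>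
        borel_measurable lebesgue" for M
      by (intro borel_measurable_add um')
    show "(\<integral>\<^sup>+x. indicator (dint (- int M, 0)) x * u M x + indicator (dint (- int M, -1)) x * u M x \<partial>lebesgue)
        \<le> ennreal K + ennreal K" for M
    proof (subst nn_integral_add[OF um' um'], rule add_mono)
      show "(\<integral>\<^sup>+x. indicator (dint (- int M, k)) x * u M x \<partial>lebesgue) \<le> ennreal K" for k
        using K[where N="2 * M + 1" and I="(- int M, k)"] by (simp add: u_def)
      thus "(\<integral>\<^sup>+x. indicator (dint (- int M, -1)) x * u M x \<partial>lebesgue) \<le> ennreal K" .
    qed
    show "AE x in lebesgue. ennreal (\<bar>?T x / P\<bar> powr r) \<le>
        liminf (\<lambda>M. indicator (dint (- int M, 0)) x * u M x + indicator (dint (- int M, -1)) x * u M x)"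
      using AE_convergent
    proof eventually_elim
      case (elim x)
      have "(\<lambda>M. u M x) \<longlonglongrightarrow> ennreal (\<bar>?T x / P\<bar> powr r)"
        unfolding u_def using P_pos r_pos
        by (intro tendsto_ennrealI tendsto_powr2 tendsto_rabs tendsto_divide elim tendsto_const) auto
      hence "ennreal (\<bar>?T x / P\<bar> powr r) = liminf (\<lambda>M. u M x)"
        by (intro lim_imp_Liminf[symmetric]) auto
      also have "\<dots> \<le> liminf (\<lambda>M. indicator (dint (- int M, 0)) x * u M x + indicator (dint (- int M, -1)) x * u M x)"
      proof (rule Liminf_mono)
        show "\<forall>\<^sub>F M in sequentially. u M x \<le>
            indicator (dint (- int M, 0)) x * u M x + indicator (dint (- int M, -1)) x * u M x"
          using eventually_mem_dint[of x] by eventually_elim (auto simp: indicator_def)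
      qed
      finally show ?case .
    qed
  qed
  also have "ennreal K + ennreal K = ennreal (2 * K)"
    using K0 by (subst ennreal_plus[symmetric]) auto
  finally show ?thesis .
qed

end

section \<open>Boundedness and its converse\<close>

lemma coef_eq_0:
  assumes "memLp p f" "0 < p" "Lp_norm p f = 0"
  shows "coef f I a = 0"
proof -
  have "(\<integral>x. \<bar>f x\<bar> powr p \<partial>lebesgue) = 0"
    using Lp_norm_powr[OF assms(2), of f] assms(3) by simp
  hence "AE x in lebesgue. \<bar>f x\<bar> powr p = 0"
    using assms(1) by (subst (asm) integral_nonneg_eq_0_iff_AE) (auto simp: memLp_def)
  hence ae: "AE x in lebesgue. f x = 0" by eventually_elim simp
  have "(\<integral>x. f x * haar I x \<partial>lebesgue) = 0"
    by (rule integral_eq_zero_AE) (use ae in \<open>auto elim!: eventually_mono\<close>)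
  moreover have "(LINT x:dint I|lebesgue. f x) = 0"
    unfolding set_lebesgue_integral_def
    by (rule integral_eq_zero_AE) (use ae in \<open>auto elim!: eventually_mono\<close>)
  ultimately show ?thesis by (simp add: coef_def)
qed

lemma haar_mult_eq_0:
  assumes "j < length \<alpha>" "\<And>I a. coef (f j) I a = 0"
  shows "haar_mult \<epsilon> \<alpha> f = (\<lambda>_. 0)"
proof -
  have "(\<Prod>j<length \<alpha>. coef (f j) I (\<alpha> ! j)) = 0" for I
    by (rule prod_zero) (use assms in \<open>blast+\<close>)
  thus ?thesis
    by (simp add: haar_mult_def haar_term_def fun_eq_iff del: prod_zero_iff)
qed

lemma sigma_nonzero:
  assumes "\<alpha> \<in> U m"
  shows "sigma \<alpha> \<noteq> 0"
proof
  assume "sigma \<alpha> = 0"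
  hence "\<forall>a\<in>set \<alpha>. a \<noteq> 0" by (simp add: sigma_def filter_empty_conv)
  hence "\<forall>a\<in>set \<alpha>. a = 1" using assms by (auto simp: U_def)
  hence "\<alpha> = replicate (length \<alpha>) 1" by (metis replicate_length_same)
  thus False using assms by (auto simp: U_def)
qed

lemma bounded_weak_if_bdd:
  assumes len: "length \<alpha> = m" and sig: "sigma \<alpha> \<noteq> 0" and B: "0 < B" "\<And>I. \<bar>\<epsilon> I\<bar> \<le> B"
    and p: "\<And>j. j < m \<Longrightarrow> 1 \<le> p j" and pr: "(\<Sum>j<m. 1 / p j) = 1 / r"
  shows "bounded_weak \<epsilon> \<alpha> p r"
proof -
  define K where "K = 2 * (2 * 2 powr r * (\<Sum>j<m. 2 powr p j) * good_lambda_const m B r powr (- r))"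
  have K: "0 \<le> K" unfolding K_def by (intro mult_nonneg_nonneg sum_nonneg) auto
  show ?thesis
    unfolding bounded_weak_def len
  proof (intro exI[of _ "K powr (1 / r)"] allI impI)
    fix f assume "\<forall>j<m. memLp (p j) (f j)"
    hence f: "memLp (p j) (f j)" if "j < m" for j using that by blast
    show "weak_Lp_le r (haar_mult \<epsilon> \<alpha> f) (K powr (1 / r) * (\<Prod>j<m. Lp_norm (p j) (f j)))"
    proof (cases "\<exists>j<m. Lp_norm (p j) (f j) = 0")
      case True
      then obtain j where j: "j < m" "Lp_norm (p j) (f j) = 0" by blast
      have "coef (f j) I a = 0" for I a
        using coef_eq_0[OF f[OF j(1)] _ j(2)] p[OF j(1)] by simp
      hence "haar_mult \<epsilon> \<alpha> f = (\<lambda>_. 0)" using haar_mult_eq_0[of j] j(1) len by simp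
      moreover have "(\<Prod>j<m. Lp_norm (p j) (f j)) = 0" using j by (intro prod_zero) auto
      ultimately show ?thesis by (simp add: weak_Lp_le_def del: prod_zero_iff)
    next
      case False
      interpret haar_setup_Lp m \<epsilon> \<alpha> f B p r
      proof unfold_locales
        show "0 < Lp_norm (p j) (f j)" if "j < m" for j
          using False that by (auto simp: Lp_norm_def less_le)
        show "locint (f j)" if "j < m" for j
          using p[OF that] memLp_locint[OF f[OF that]] by auto
      qed (use assms f in auto)
      show ?thesis
        unfolding weak_Lp_le_def P_def[symmetric]
      proof (intro conjI allI impI haar_mult_measurable)
        fix t :: real assume t: "0 < t"
        let ?S = "{x. t < \<bar>haar_mult \<epsilon> \<alpha> f x\<bar>}"
        have le: "emeasure lebesgue ?S \<le> ennreal (K * P powr r * t powr (- r))"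
          using emeasure_haar_mult_weak[OF t] by (simp add: K_def mult.assoc)
        thus "emeasure lebesgue ?S < \<infinity>" by (simp add: order_le_less_trans)
        have "measure lebesgue ?S \<le> K * P powr r * t powr (- r)"
          unfolding measure_def using le K by (intro enn2real_leI) auto
        hence "measure lebesgue ?S powr (1 / r) \<le> (K * P powr r * t powr (- r)) powr (1 / r)"
          using r_pos by (intro powr_mono2) auto
        also have "\<dots> = K powr (1 / r) * P * t powr (- 1)"
          using K P_pos r_pos t by (simp add: powr_mult powr_powr)
        finally have "t * measure lebesgue ?S powr (1 / r) \<le> t * (K powr (1 / r) * P * t powr (- 1))"
          using t by (intro mult_left_mono) auto
        also have "\<dots> = K powr (1 / r) * P" using t by (simp add: powr_minus)
        finally show "t * measure lebesgue ?S powr (1 / r) \<le> K powr (1 / r) * P" .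
      qed
    qed
  qed
qed

lemma bounded_strong_if_bdd:
  assumes len: "length \<alpha> = m" and sig: "sigma \<alpha> \<noteq> 0" and B: "0 < B" "\<And>I. \<bar>\<epsilon> I\<bar> \<le> B"
    and p1: "\<And>j. j < m \<Longrightarrow> 1 < p j" and pr: "(\<Sum>j<m. 1 / p j) = 1 / r"
  shows "bounded_strong \<epsilon> \<alpha> p r"
proof -
  define Q where "Q = (\<lambda>j. (2 powr (r / p j)) powr (p j - 1))"
  define K0 where "K0 = 2 powr r * (2 * 2 powr r *
    (\<Sum>j<m. Q j / (Q j - 1) * (2 powr p j * good_lambda_const m B r powr (- r))))"
  \<comment> \<open>The sign of \<open>K0\<close> rests on \<open>Q j > 1\<close>, hence on
    \<open>0 < r\<close>, which is derived only after the locale is interpreted; the maximum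
    supplies it at once.\<close>
  define K where "K = 2 * max 0 K0"
  have K: "0 \<le> K" by (simp add: K_def)
  show ?thesis
    unfolding bounded_strong_def len
  proof (intro exI[of _ "K powr (1 / r)"] allI impI)
    fix f assume "\<forall>j<m. memLp (p j) (f j)"
    hence f: "memLp (p j) (f j)" if "j < m" for j using that by blast
    show "memLp r (haar_mult \<epsilon> \<alpha> f) \<and>
        Lp_norm r (haar_mult \<epsilon> \<alpha> f) \<le> K powr (1 / r) * (\<Prod>j<m. Lp_norm (p j) (f j))"
    proof (cases "\<exists>j<m. Lp_norm (p j) (f j) = 0")
      case True
      then obtain j where j: "j < m" "Lp_norm (p j) (f j) = 0" by blast
      have "coef (f j) I a = 0" for I a
        using coef_eq_0[OF f[OF j(1)] _ j(2)] p1[OF j(1)] by simp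
      hence "haar_mult \<epsilon> \<alpha> f = (\<lambda>_. 0)" using haar_mult_eq_0[of j] j(1) len by simp
      moreover have "(\<Prod>j<m. Lp_norm (p j) (f j)) = 0" using j by (intro prod_zero) auto
      ultimately show ?thesis 
        by (simp add: memLp_def Lp_norm_def[of r] del: prod_zero_iff)
    next
      case False
      interpret haar_setup_Lp m \<epsilon> \<alpha> f B p r
      proof unfold_locales
        show "0 < Lp_norm (p j) (f j)" if "j < m" for j
          using False that by (auto simp: Lp_norm_def less_le)
        show "1 \<le> p j" "locint (f j)" if "j < m" for j
          using p1[OF that] memLp_locint[OF f[OF that]] by auto
      qed (use assms f in auto)
      let ?T = "haar_mult \<epsilon> \<alpha> f"
      have "(\<integral>\<^sup>+x. ennreal (\<bar>?T x / P\<bar> powr r) \<partial>lebesgue) \<le> ennreal K"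
        unfolding K_def
      proof (rule nn_integral_haar_mult_strong)
        fix N I
        have "(\<integral>\<^sup>+x. indicator (dint I) x * ennreal (\<bar>path_sum c e N (fst I) x / P\<bar> powr r) \<partial>lebesgue) \<le> ennreal K0"
          unfolding K0_def Q_def by (rule nn_integral_path_sum_strong) (rule p1)
        also have "\<dots> \<le> ennreal (max 0 K0)" by (intro ennreal_leI) simp
        finally show "(\<integral>\<^sup>+x. indicator (dint I) x * ennreal (\<bar>path_sum c e N (fst I) x / P\<bar> powr r) \<partial>lebesgue) \<le>
            ennreal (max 0 K0)" .
      qed simp
      note nn = this
      have m: "(\<lambda>x. \<bar>?T x / P\<bar> powr r) \<in> borel_measurable lebesgue"
        by (intro powr_real_measurable borel_measurable_abs borel_measurable_divide
            haar_mult_measurable borel_measurable_const)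
      have i: "integrable lebesgue (\<lambda>x. \<bar>?T x / P\<bar> powr r)"
        using nn by (intro integrableI_bounded m) (auto simp: order_le_less_trans)
      have "ennreal (\<integral>x. \<bar>?T x / P\<bar> powr r \<partial>lebesgue) \<le> ennreal K"
        using nn by (subst nn_integral_eq_integral[symmetric, OF i]) auto
      hence le: "(\<integral>x. \<bar>?T x / P\<bar> powr r \<partial>lebesgue) \<le> K" using K by simp
      have eq: "(\<lambda>x. \<bar>?T x\<bar> powr r) = (\<lambda>x. P powr r * \<bar>?T x / P\<bar> powr r)"
        using P_pos by (auto simp: fun_eq_iff powr_divide)
      have "memLp r ?T"
        unfolding memLp_def eq using i haar_mult_measurable by auto
      moreover have "Lp_norm r ?T \<le> K powr (1 / r) * P"
      proof -
        have "(\<integral>x. \<bar>?T x\<bar> powr r \<partial>lebesgue) \<le> P powr r * K"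
          unfolding eq using le by (simp add: mult_left_mono)
        hence "Lp_norm r ?T \<le> (P powr r * K) powr (1 / r)"
          unfolding Lp_norm_def using r_pos by (intro powr_mono2) auto
        also have "\<dots> = K powr (1 / r) * P"
          using K P_pos r_pos by (simp add: powr_mult powr_powr)
        finally show ?thesis .
      qed
      ultimately show ?thesis by (simp add: P_def)
    qed
  qed
qed

section \<open>Nesting of dyadic intervals, orthogonality of Haar functions, and the
  converse\<close>

lemma dyad_coarsen:
  assumes "dyad (n + int d) x = dyad (n + int d) y"
  shows "dyad n x = dyad n y"
  using assms
proof (induction d)
  case (Suc d)
  have par: "dyad n z = (n, snd (dyad (n + 1) z) div 2)" for n z
  proof -
    have "z \<in> dint (left_child (dyad n z)) \<or> z \<in> dint (right_child (dyad n z))"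
      using mem_dint_dyad[of z n] dint_children[of "dyad n z"] by auto
    hence "dyad (n + 1) z = left_child (dyad n z) \<or> dyad (n + 1) z = right_child (dyad n z)"
      by (simp add: mem_dint_iff)
    hence "snd (dyad (n + 1) z) div 2 = snd (dyad n z)" by (auto simp: left_child_def right_child_def)
    thus ?thesis by (metis fst_dyad prod.collapse)
  qed
  have "dyad (n + int d) x = dyad (n + int d) y"
    using Suc.prems par[of "n + int d"] by (simp add: add_ac)
  thus ?case by (rule Suc.IH)
qed simp

lemma dint_nested:
  assumes "x \<in> dint I" "x \<in> dint J" "fst I \<le> fst J"
  shows "dint J \<subseteq> dint I"
proof
  fix y assume "y \<in> dint J"
  hence "dyad (fst J) y = dyad (fst J) x" using assms by (simp add: mem_dint_iff)
  hence "dyad (fst I) y = dyad (fst I) x"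
    using dyad_coarsen[of "fst I" "nat (fst J - fst I)" y x] assms(3) by simp
  thus "y \<in> dint I" using assms by (simp add: mem_dint_iff)
qed

lemma integrable_indicator_dint: "integrable lebesgue (indicator (dint I) :: real \<Rightarrow> real)"
  by (simp add: emeasure_dint)

lemma integral_haar: "(\<integral>x. haar I x \<partial>lebesgue) = 0"
  unfolding haar_def dleft_eq dright_eq using integrable_indicator_dint
  by (simp add: Bochner_Integration.integral_diff)

text \<open>A finer interval that meets \<open>dint I\<close> lies in one half of it, where
  \<open>haar I\<close> is constant; what remains is a multiple of the vanishing mean of
  \<open>haar J\<close>.\<close>

lemma haar_orthogonal_less:
  assumes "fst I < fst J"
  shows "(\<integral>x. haar I x * haar J x \<partial>lebesgue) = 0"
proof (cases "dint I \<inter> dint J = {}")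
  case True
  hence "haar I x * haar J x = 0" for x
    using haar_outside[of x I] haar_outside[of x J] by auto
  thus ?thesis by (simp only: integral_zero)
next
  case False
  then obtain x where x: "x \<in> dint I" "x \<in> dint J" by blast
  have "\<exists>v. \<forall>y\<in>dint J. haar I y = v"
  proof (cases "x \<in> dint (left_child I)")
    case True
    hence "dint J \<subseteq> dint (left_child I)" using x assms by (intro dint_nested[of x]) auto
    thus ?thesis using dint_children_disjoint[of I]
      by (intro exI[of _ "dlen I powr (-1/2) * (0 - 1)"])
        (auto simp: haar_def dleft_eq dright_eq indicator_def)
  next
    case False
    hence "x \<in> dint (right_child I)" using x dint_children[of I] by blast
    hence "dint J \<subseteq> dint (right_child I)" using x assms by (intro dint_nested[of x]) auto
    thus ?thesis using dint_children_disjoint[of I]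
      by (intro exI[of _ "dlen I powr (-1/2) * (1 - 0)"])
        (auto simp: haar_def dleft_eq dright_eq indicator_def)
  qed
  then obtain v where v: "\<And>y. y \<in> dint J \<Longrightarrow> haar I y = v" by blast
  have "haar I y * haar J y = v * haar J y" for y
    using v[of y] haar_outside[of y J] by (cases "y \<in> dint J") auto
  thus ?thesis by (simp only: integral_mult_right_zero integral_haar mult_zero_right)
qed

lemma haar_orthogonal:
  assumes "I \<noteq> J"
  shows "(\<integral>x. haar I x * haar J x \<partial>lebesgue) = 0"
proof -
  consider "fst I < fst J" | "fst J < fst I" | "fst I = fst J" by linarith
  thus ?thesis
  proof cases
    case 2
    thus ?thesis using haar_orthogonal_less[OF 2] by (simp add: mult.commute)
  next
    case 3
    hence "x \<notin> dint I \<or> x \<notin> dint J" for x using assms by (auto simp: mem_dint_iff)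
    hence "haar I x * haar J x = 0" for x using haar_outside[of x I] haar_outside[of x J] by auto
    thus ?thesis by (simp only: integral_zero)
  qed (rule haar_orthogonal_less)
qed

lemma abs_haar: "\<bar>haar I x\<bar> = dlen I powr (-1/2) * indicator (dint I) x"
proof (cases "x \<in> dint I")
  case True
  from haar_power[OF this, of 1] show ?thesis using True by (simp add: abs_mult)
qed (simp add: haar_outside)

lemma haar_norm: "(\<integral>x. haar I x * haar I x \<partial>lebesgue) = 1"
proof -
  have "haar I x * haar I x = inverse (dlen I) * indicator (dint I) x" for x
  proof -
    have "haar I x * haar I x = \<bar>haar I x\<bar> * \<bar>haar I x\<bar>" by simp
    also have "\<dots> = (dlen I powr (-1/2) * dlen I powr (-1/2)) * indicator (dint I) x"
      unfolding abs_haar by (simp add: indicator_def)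
    also have "dlen I powr (-1/2) * dlen I powr (-1/2) = inverse (dlen I)"
      by (simp add: powr_minus_divide inverse_eq_divide flip: powr_add)
    finally show ?thesis .
  qed
  thus ?thesis by simp
qed

lemma haar_measurable: "haar I \<in> borel_measurable lebesgue"
  unfolding haar_def dleft_eq dright_eq
  by (intro borel_measurable_times borel_measurable_diff borel_measurable_indicator
      borel_measurable_const dint_sets)

text \<open>Serves the Haar function, the indicator and the output of the multiplier alike, as all
  three have constant modulus on \<open>dint I\<close> and vanish elsewhere.\<close>

lemma memLp_abs_eq_indicator:
  assumes "h \<in> borel_measurable lebesgue" "\<And>x. \<bar>h x\<bar> = a * indicator (dint I) x" "0 < p" "0 \<le> a"
  shows "memLp p h" "Lp_norm p h = a * dlen I powr (1 / p)"
proof -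
  have eq: "(\<lambda>x. \<bar>h x\<bar> powr p) = (\<lambda>x. a powr p * indicator (dint I) x)"
    unfolding assms(2) by (auto simp: fun_eq_iff indicator_def)
  show "memLp p h"
    unfolding memLp_def eq using assms(1) integrable_indicator_dint[of I] by auto
  have "Lp_norm p h = (a powr p * dlen I) powr (1 / p)"
    unfolding Lp_norm_def eq by simp
  also have "\<dots> = a * dlen I powr (1 / p)"
    using assms(3,4) by (simp add: powr_mult powr_powr)
  finally show "Lp_norm p h = a * dlen I powr (1 / p)" .
qed

text \<open>Every slot gets the function whose coefficient at \<open>I\<close> is 1. At any other
  interval a slot with entry 0 contributes a factor 0 by orthogonality, and such a slot exists when
  \<open>sigma \<alpha>\<close> is non-zero.\<close>

definition haar_test :: "nat list \<Rightarrow> int \<times> int \<Rightarrow> nat \<Rightarrow> real \<Rightarrow> real" where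
  "haar_test \<alpha> I j = (if \<alpha> ! j = 0 then haar I else indicator (dint I))"

lemma haar_mult_test:
  assumes "sigma \<alpha> \<noteq> 0"
  shows "haar_mult \<epsilon> \<alpha> (haar_test \<alpha> I) x = \<epsilon> I * haar I x ^ sigma \<alpha>"
proof -
  have "(\<Prod>j<length \<alpha>. coef (haar_test \<alpha> I j) I (\<alpha> ! j)) = 1"
    by (intro prod.neutral)
      (auto simp: haar_test_def coef_def haar_norm set_lebesgue_integral_def simp flip: indicator_inter_arith)
  hence self: "haar_term \<epsilon> \<alpha> (haar_test \<alpha> I) I x = \<epsilon> I * haar I x ^ sigma \<alpha>"
    by (simp add: haar_term_def)
  have other: "haar_term \<epsilon> \<alpha> (haar_test \<alpha> I) J x = 0" if "J \<noteq> I" for J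
  proof -
    obtain j where j: "j < length \<alpha>" "\<alpha> ! j = 0"
      using assms by (auto simp: sigma_def filter_empty_conv in_set_conv_nth)
    have "coef (haar_test \<alpha> I j) J (\<alpha> ! j) = 0"
      using j haar_orthogonal[of I J] that by (simp add: haar_test_def coef_def)
    hence "(\<Prod>j<length \<alpha>. coef (haar_test \<alpha> I j) J (\<alpha> ! j)) = 0"
      by (intro prod_zero bexI[of _ j]) (use j in auto)
    thus ?thesis by (simp add: haar_term_def)
  qed
  obtain n0 k0 where I: "I = (n0, k0)" by (cases I)
  have inner: "(\<Sum>\<^sub>\<infinity>k::int. haar_term \<epsilon> \<alpha> (haar_test \<alpha> I) (n, k) x) =
      (if n = n0 then \<epsilon> I * haar I x ^ sigma \<alpha> else 0)" for n
  proof (rule infsumI, rule has_sum_finite_neutralI[where B="{k0}"])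
    show "haar_term \<epsilon> \<alpha> (haar_test \<alpha> I) (n, k) x = 0" if "k \<in> UNIV - {k0}" for k
      using that by (intro other) (simp add: I)
    show "(if n = n0 then \<epsilon> I * haar I x ^ sigma \<alpha> else 0) =
        (\<Sum>k\<in>{k0}. haar_term \<epsilon> \<alpha> (haar_test \<alpha> I) (n, k) x)"
      using self other[of "(n, k0)"] by (simp add: I)
  qed auto
  have "(\<lambda>N. \<Sum>n\<in>{- int N..int N}. \<Sum>\<^sub>\<infinity>k::int. haar_term \<epsilon> \<alpha> (haar_test \<alpha> I) (n, k) x)
      \<longlonglongrightarrow> \<epsilon> I * haar I x ^ sigma \<alpha>"
    unfolding inner
  proof (rule tendsto_eventually, rule eventually_sequentiallyI)
    fix N assume "nat \<bar>n0\<bar> \<le> N"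
    thus "(\<Sum>n\<in>{- int N..int N}. if n = n0 then \<epsilon> I * haar I x ^ sigma \<alpha> else 0) =
        \<epsilon> I * haar I x ^ sigma \<alpha>"
      by (subst sum.delta) auto
  qed
  thus ?thesis unfolding haar_mult_def by (rule limI)
qed

text \<open>For the test functions both sides of the norm inequality carry the same positive factor,
  the product of the \<open>a j\<close> times \<open>dlen I powr (1 / r)\<close>. Cancelling it
  bounds every |epsilon_I| by the operator constant itself.\<close>

lemma bdd_if_bounded_strong:
  assumes len: "length \<alpha> = m" and sig: "sigma \<alpha> \<noteq> 0"
    and p: "\<And>j. j < m \<Longrightarrow> 1 < p j" and pr: "(\<Sum>j<m. 1 / p j) = 1 / r"
    and b: "bounded_strong \<epsilon> \<alpha> p r"
  shows "bdd_above (range (\<lambda>I. \<bar>\<epsilon> I\<bar>))"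
proof -
  have m: "0 < m" using len sig by (cases \<alpha>) (auto simp: sigma_def)
  have r: "0 < r"
  proof -
    have "0 < (\<Sum>j<m. 1 / p j)"
      using m p by (intro sum_pos) (force intro!: divide_pos_pos)+
    thus ?thesis unfolding pr by simp
  qed
  obtain C where C: "\<And>f. (\<And>j. j < m \<Longrightarrow> memLp (p j) (f j)) \<Longrightarrow>
      Lp_norm r (haar_mult \<epsilon> \<alpha> f) \<le> C * (\<Prod>j<m. Lp_norm (p j) (f j))"
    using b unfolding bounded_strong_def len by blast
  have "\<bar>\<epsilon> I\<bar> \<le> C" for I
  proof -
    define a where "a j = (if \<alpha> ! j = 0 then dlen I powr (-1/2) else 1)" for j
    have t: "haar_test \<alpha> I j \<in> borel_measurable lebesgue" "\<bar>haar_test \<alpha> I j x\<bar> = a j * indicator (dint I) x" for j x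
      by (auto simp: haar_test_def a_def haar_measurable abs_haar)
    have a0: "0 \<le> a j" for j by (simp add: a_def)
    have p0: "0 < p j" if "j < m" for j using p[OF that] by simp
    have prod_a: "(\<Prod>j<m. a j) = dlen I powr (- real (sigma \<alpha>) / 2)"
    proof -
      have "(\<Prod>j<m. a j) = (\<Prod>j\<in>{j \<in> {..<m}. \<alpha> ! j = 0}. dlen I powr (-1/2))"
        unfolding a_def by (rule prod.inter_filter[symmetric]) simp
      also have "\<dots> = (dlen I powr (-1/2)) ^ sigma \<alpha>"
        by (simp add: sigma_def length_filter_conv_card len)
      also have "\<dots> = dlen I powr (- real (sigma \<alpha>) / 2)"
        by (subst powr_power) auto
      finally show ?thesis .
    qed
    have T: "haar_mult \<epsilon> \<alpha> (haar_test \<alpha> I) = (\<lambda>x. \<epsilon> I * haar I x ^ sigma \<alpha>)"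
      using haar_mult_test[OF sig] by (simp add: fun_eq_iff)
    have "\<bar>\<epsilon> I * haar I x ^ sigma \<alpha>\<bar> = \<bar>\<epsilon> I\<bar> * (\<Prod>j<m. a j) * indicator (dint I) x" for x
    proof (cases "x \<in> dint I")
      case True
      have "\<bar>haar I x ^ sigma \<alpha>\<bar> = dlen I powr (- real (sigma \<alpha>) / 2)"
        unfolding haar_power[OF True] by (simp add: abs_mult power_abs)
      thus ?thesis using True by (simp add: abs_mult prod_a)
    qed (use sig in \<open>simp add: haar_outside\<close>)
    hence "Lp_norm r (haar_mult \<epsilon> \<alpha> (haar_test \<alpha> I)) = \<bar>\<epsilon> I\<bar> * (\<Prod>j<m. a j) * dlen I powr (1 / r)"
      unfolding T using r a0 haar_measurable
      by (intro memLp_abs_eq_indicator) (auto intro!: mult_nonneg_nonneg prod_nonneg)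
    moreover have "(\<Prod>j<m. Lp_norm (p j) (haar_test \<alpha> I j)) = (\<Prod>j<m. a j) * dlen I powr (1 / r)"
    proof -
      have "(\<Prod>j<m. Lp_norm (p j) (haar_test \<alpha> I j)) = (\<Prod>j<m. a j * dlen I powr (1 / p j))"
        using memLp_abs_eq_indicator(2)[OF t p0 a0] by (intro prod.cong) auto
      also have "\<dots> = (\<Prod>j<m. a j) * (\<Prod>j<m. dlen I powr (1 / p j))" by (rule prod.distrib)
      also have "(\<Prod>j<m. dlen I powr (1 / p j)) = dlen I powr (1 / r)"
        unfolding pr[symmetric] by (intro powr_sum[symmetric]) simp
      finally show ?thesis .
    qed
    moreover have "Lp_norm r (haar_mult \<epsilon> \<alpha> (haar_test \<alpha> I)) \<le> C * (\<Prod>j<m. Lp_norm (p j) (haar_test \<alpha> I j))"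
      by (rule C) (rule memLp_abs_eq_indicator(1)[OF t p0 a0])
    moreover have "0 < (\<Prod>j<m. a j) * dlen I powr (1 / r)" unfolding prod_a by simp
    ultimately show ?thesis by (simp add: mult.assoc mult_le_cancel_right del: zero_less_mult_iff)
  qed
  thus ?thesis by (intro bdd_aboveI[of _ C]) auto
qed

theorem theorem4p1:
  fixes m :: nat and \<epsilon> :: "int \<times> int \<Rightarrow> real" and \<alpha> :: "nat list"
  assumes "m \<ge> 2" and "\<alpha> \<in> U m"
  shows "(\<forall>(p :: nat \<Rightarrow> real) (r :: real).
            (\<forall>j<m. 1 < p j) \<and> (\<Sum>j<m. 1 / p j) = 1 / r \<longrightarrow>
            (bounded_strong \<epsilon> \<alpha> p r \<longleftrightarrow> bdd_above (range (\<lambda>I. \<bar>\<epsilon> I\<bar>))))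
       \<and> (bdd_above (range (\<lambda>I. \<bar>\<epsilon> I\<bar>)) \<longrightarrow>
           (\<forall>(p :: nat \<Rightarrow> real) (r :: real).
            (\<forall>j<m. 1 \<le> p j) \<and> (\<Sum>j<m. 1 / p j) = 1 / r \<longrightarrow>
            bounded_weak \<epsilon> \<alpha> p r))"
proof -
  have len: "length \<alpha> = m" and sig: "sigma \<alpha> \<noteq> 0"
    using assms(2) sigma_nonzero by (auto simp: U_def)
  have B: "\<exists>B>0. \<forall>I. \<bar>\<epsilon> I\<bar> \<le> B" if bdd: "bdd_above (range (\<lambda>I. \<bar>\<epsilon> I\<bar>))"
  proof -
    from bdd obtain b where b: "\<And>I. \<bar>\<epsilon> I\<bar> \<le> b" by (auto simp: bdd_above_def)
    \<comment> \<open>The bound is made strictly positive because \<open>good_lambda_const\<close>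
      divides by it; the zero symbol would otherwise allow 0.\<close>
    have "\<bar>\<epsilon> I\<bar> \<le> max 1 b" for I using b[of I] by simp
    thus ?thesis by (intro exI[of _ "max 1 b"]) auto
  qed
  show ?thesis
  proof (intro conjI allI impI)
    fix p :: "nat \<Rightarrow> real" and r :: real assume pr: "(\<forall>j<m. 1 < p j) \<and> (\<Sum>j<m. 1 / p j) = 1 / r"
    show "bounded_strong \<epsilon> \<alpha> p r \<longleftrightarrow> bdd_above (range (\<lambda>I. \<bar>\<epsilon> I\<bar>))"
    proof
      assume "bounded_strong \<epsilon> \<alpha> p r"
      thus "bdd_above (range (\<lambda>I. \<bar>\<epsilon> I\<bar>))"
        using pr by (intro bdd_if_bounded_strong[OF len sig, of p r \<epsilon>]) auto
    next
      assume "bdd_above (range (\<lambda>I. \<bar>\<epsilon> I\<bar>))"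
      from B[OF this] obtain b where "0 < b" "\<And>I. \<bar>\<epsilon> I\<bar> \<le> b" by blast
      thus "bounded_strong \<epsilon> \<alpha> p r"
        using bounded_strong_if_bdd[OF len sig, of b \<epsilon> p r] pr by blast
    qed
  next
    fix p :: "nat \<Rightarrow> real" and r :: real assume bdd: "bdd_above (range (\<lambda>I. \<bar>\<epsilon> I\<bar>))"
      and pr: "(\<forall>j<m. 1 \<le> p j) \<and> (\<Sum>j<m. 1 / p j) = 1 / r"
    from B[OF bdd] obtain b where "0 < b" "\<And>I. \<bar>\<epsilon> I\<bar> \<le> b" by blast
    thus "bounded_weak \<epsilon> \<alpha> p r"
      using bounded_weak_if_bdd[OF len sig, of b \<epsilon> p r] pr by blast
  qed
qed

end
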